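(* Let $A$ be a Banach algebra and let $e\in A$ be an element of the closed unit ball of $A$. Suppose that $A_e$ is unital. Then $A$ is Johnson pseudo-contractible if and only if $A_e$ is Johnson pseudo-contractible.
   Context: For a Banach algebra $A$ and an element $e$ of the closed unit ball $\overline{B^0_1}$ of $A$ (so $\|e\|\le 1$), $A_e$ denotes the Banach algebra whose underlying Banach space is $A$ and whose product is $a\ast b=aeb$. For a Banach algebra $A$, the projective tensor product $A\otimes_p A$ is a Banach $A$-bimodule via $a\cdot(b\otimes c)=ab\otimes c$ and $(b\otimes c)\cdot a=b\otimes ca$, and $\pi_A:A\otimes_pA\to A$ is the bounded linear map determined by $\pi_A(a\otimes b)=ab$ (for $A_e$ all of these are formed with the product $\ast$). The second dual $(A\otimes_pA)^{**}$ carries the canonical dual $A$-bimodule structure, $\pi_A^{**}:(A\otimes_pA)^{**}\to A^{**}$ is the second adjoint of $\pi_A$, and $A$ is identified with its canonical image in the $A$-bimodule $A^{**}$. A Banach algebra $A$ is called Johnson pseudo-contractible if there exists a (not necessarily bounded) net $(m_\alpha)$ in $(A\otimes_pA)^{**}$ such that, for every $a\in A$, $a\cdot m_\alpha=m_\alpha\cdot a$ for all $\alpha$ and $\pi_A^{**}(m_\alpha)a-a\to0$ in norm. *)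

theory Defs
  imports "HOL-Analysis.Analysis"
begin

section \<open>Complex Banach spaces\<close>

class complex_vector = real_vector +
  fixes scaleC :: "complex \<Rightarrow> 'a \<Rightarrow> 'a" (infixr \<open>*\<^sub>C\<close> 75)
  assumes scaleC_add_right: "c *\<^sub>C (x + y) = c *\<^sub>C x + c *\<^sub>C y"
    and scaleC_add_left: "(c + d) *\<^sub>C x = c *\<^sub>C x + d *\<^sub>C x"
    and scaleC_scaleC: "c *\<^sub>C (d *\<^sub>C x) = (c * d) *\<^sub>C x"
    and scaleC_one: "1 *\<^sub>C x = x"
    and scaleC_of_real: "of_real r *\<^sub>C x = r *\<^sub>R x"

class complex_normed_vector = complex_vector + real_normed_vector +
  assumes norm_scaleC: "norm (c *\<^sub>C x) = cmod c * norm x"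

class complex_banach = complex_normed_vector + banach

lemma vector_space_scaleC: "vector_space (scaleC :: complex \<Rightarrow> 'a::complex_vector \<Rightarrow> 'a)"
  by standard (simp_all add: scaleC_add_right scaleC_add_left scaleC_scaleC scaleC_one)

lemma scaleC_minus1: "(-1) *\<^sub>C x = - (x :: 'a::complex_vector)"
  using scaleC_of_real[of "-1" x] by simp

lemma scaleC_minus_right: "c *\<^sub>C (- x) = - (c *\<^sub>C (x :: 'a::complex_vector))"
  by (metis scaleC_minus1 scaleC_scaleC mult.commute)

lemma scaleC_diff_right: "c *\<^sub>C (x - y) = c *\<^sub>C x - c *\<^sub>C (y :: 'a::complex_vector)"
  using scaleC_add_right[of c x "-y"] by (simp add: scaleC_minus_right)

lemma scaleC_zero_left [simp]: "0 *\<^sub>C x = (0 :: 'a::complex_vector)"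
  using scaleC_of_real[of 0 x] by simp

lemma scaleC_zero_right [simp]: "c *\<^sub>C 0 = (0 :: 'a::complex_vector)"
  using scaleC_diff_right[of c 0 0] by simp

instantiation complex :: complex_banach
begin
definition scaleC_complex :: "complex \<Rightarrow> complex \<Rightarrow> complex" where
  "scaleC_complex c x = c * x"
instance
  by standard (simp_all add: scaleC_complex_def algebra_simps norm_mult scaleR_conv_of_real)
end

definition bounded_clinear :: "('a::complex_normed_vector \<Rightarrow> 'b::complex_normed_vector) \<Rightarrow> bool" where
  "bounded_clinear f \<longleftrightarrow> bounded_linear f \<and> (\<forall>c x. f (c *\<^sub>C x) = c *\<^sub>C f x)"

definition cbilinear ::
    "('a::complex_vector \<Rightarrow> 'b::complex_vector \<Rightarrow> 'c::complex_vector) \<Rightarrow> bool" where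
  "cbilinear B \<longleftrightarrow>
     (\<forall>x y b. B (x + y) b = B x b + B y b) \<and> (\<forall>a x y. B a (x + y) = B a x + B a y) \<and>
     (\<forall>c a b. B (c *\<^sub>C a) b = c *\<^sub>C B a b) \<and> (\<forall>c a b. B a (c *\<^sub>C b) = c *\<^sub>C B a b)"

lemma cbilinear_zero:
  assumes "cbilinear B"
  shows "B 0 b = 0" "B a 0 = 0"
  using assms unfolding cbilinear_def by (metis scaleC_zero_left)+

section \<open>Dual spaces and adjoints\<close>

text \<open>The operator norm of a complex-linear functional does not depend on whether it is viewed
  over the reals or over the complex numbers, so the dual is cut out of the real-linear maps.\<close>

typedef (overloaded) 'a cdual =
    "{f :: 'a::complex_normed_vector \<Rightarrow>\<^sub>L complex. \<forall>c x. blinfun_apply f (c *\<^sub>C x) = c * blinfun_apply f x}"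
  by (rule exI[of _ 0]) simp

setup_lifting type_definition_cdual

lift_definition cdual_apply :: "'a::complex_normed_vector cdual \<Rightarrow> 'a \<Rightarrow> complex" is blinfun_apply .

definition CDual :: "('a::complex_normed_vector \<Rightarrow> complex) \<Rightarrow> 'a cdual" where
  "CDual f = Abs_cdual (Blinfun f)"

lemma Blinfun_cmult_apply:
  "blinfun_apply (Blinfun (\<lambda>x. c * blinfun_apply f x)) x = c * blinfun_apply f (x :: 'a::real_normed_vector)"
  for c :: complex
  by (subst bounded_linear_Blinfun_apply[OF bounded_linear_const_mult[OF blinfun.bounded_linear_right]])
    (rule refl)

lemma norm_Blinfun_cmult_le:
  "norm (Blinfun (\<lambda>x. c * blinfun_apply f x)) \<le> cmod c * norm (f :: 'a::real_normed_vector \<Rightarrow>\<^sub>L complex)"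
  by (rule norm_blinfun_bound)
    (auto simp: Blinfun_cmult_apply norm_mult mult.assoc intro!: mult_left_mono norm_blinfun)

lemma norm_Blinfun_cmult:
  "norm (Blinfun (\<lambda>x. c * blinfun_apply f x)) = cmod c * norm (f :: 'a::real_normed_vector \<Rightarrow>\<^sub>L complex)"
proof (cases "c = 0")
  case True
  then have "norm (Blinfun (\<lambda>x. c * blinfun_apply f x)) \<le> 0"
    using norm_Blinfun_cmult_le[of c f] by simp
  then show ?thesis using True by simp
next
  case False
  define g where "g = Blinfun (\<lambda>x. c * blinfun_apply f x)"
  have g: "blinfun_apply g x = c * blinfun_apply f x" for x
    by (simp add: g_def Blinfun_cmult_apply)
  have "f = Blinfun (\<lambda>x. inverse c * blinfun_apply g x)"
    by (rule blinfun_eqI, subst Blinfun_cmult_apply) (use False in \<open>simp add: g\<close>)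
  then have "norm f \<le> cmod (inverse c) * norm g"
    using norm_Blinfun_cmult_le[of "inverse c" g] by simp
  then have "cmod c * norm f \<le> norm g"
    using False by (simp add: norm_divide field_simps)
  then show ?thesis using norm_Blinfun_cmult_le[of c f] by (simp add: g_def)
qed

instantiation cdual :: (complex_normed_vector) complex_normed_vector
begin

lift_definition zero_cdual :: "'a cdual" is 0 by simp
lift_definition plus_cdual :: "'a cdual \<Rightarrow> 'a cdual \<Rightarrow> 'a cdual" is "(+)"
  by (simp add: blinfun.add_left algebra_simps)
lift_definition minus_cdual :: "'a cdual \<Rightarrow> 'a cdual \<Rightarrow> 'a cdual" is "(-)"
  by (simp add: blinfun.diff_left algebra_simps)
lift_definition uminus_cdual :: "'a cdual \<Rightarrow> 'a cdual" is "uminus"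
  by (simp add: blinfun.minus_left algebra_simps)
lift_definition scaleR_cdual :: "real \<Rightarrow> 'a cdual \<Rightarrow> 'a cdual" is "scaleR"
  by (simp add: blinfun.scaleR_left algebra_simps)
lift_definition scaleC_cdual :: "complex \<Rightarrow> 'a cdual \<Rightarrow> 'a cdual"
  is "\<lambda>c f. Blinfun (\<lambda>x. c * blinfun_apply f x)"
  by (simp add: Blinfun_cmult_apply algebra_simps)
lift_definition norm_cdual :: "'a cdual \<Rightarrow> real" is norm .
definition dist_cdual :: "'a cdual \<Rightarrow> 'a cdual \<Rightarrow> real" where
  "dist_cdual f g = norm (f - g)"
definition uniformity_cdual :: "('a cdual \<times> 'a cdual) filter" where
  "uniformity_cdual = (INF e\<in>{0 <..}. principal {(x, y). dist x y < e})"
definition open_cdual :: "'a cdual set \<Rightarrow> bool" where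
  "open_cdual S = (\<forall>x\<in>S. \<forall>\<^sub>F (x', y) in uniformity. x' = x \<longrightarrow> y \<in> S)"
definition sgn_cdual :: "'a cdual \<Rightarrow> 'a cdual" where
  "sgn_cdual f = scaleR (inverse (norm f)) f"

instance
proof
  fix f g h :: "'a cdual" and r s :: real and c d :: complex
  show "f + g + h = f + (g + h)" by transfer simp
  show "f + g = g + f" by transfer simp
  show "0 + f = f" by transfer simp
  show "- f + f = 0" by transfer simp
  show "f - g = f + - g" by transfer simp
  show "r *\<^sub>R (f + g) = r *\<^sub>R f + r *\<^sub>R g" by transfer (simp add: algebra_simps)
  show "(r + s) *\<^sub>R f = r *\<^sub>R f + s *\<^sub>R f" by transfer (simp add: algebra_simps)
  show "r *\<^sub>R s *\<^sub>R f = (r * s) *\<^sub>R f" by transfer simp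
  show "1 *\<^sub>R f = f" by transfer simp
  show "c *\<^sub>C (f + g) = c *\<^sub>C f + c *\<^sub>C g"
    by (transfer, rule blinfun_eqI, subst Blinfun_cmult_apply)
      (simp add: Blinfun_cmult_apply blinfun.add_left algebra_simps)
  show "(c + d) *\<^sub>C f = c *\<^sub>C f + d *\<^sub>C f"
    by (transfer, rule blinfun_eqI, subst Blinfun_cmult_apply)
      (simp add: Blinfun_cmult_apply blinfun.add_left algebra_simps)
  show "c *\<^sub>C d *\<^sub>C f = (c * d) *\<^sub>C f"
    by transfer (auto intro!: blinfun_eqI
      simp: Blinfun_cmult_apply blinfun.add_left algebra_simps)
  show "1 *\<^sub>C f = f"
    by (transfer, rule blinfun_eqI, subst Blinfun_cmult_apply) simp
  show "of_real r *\<^sub>C f = r *\<^sub>R f"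
    by transfer (auto intro!: blinfun_eqI
      simp: Blinfun_cmult_apply blinfun.add_left blinfun.scaleR_left scaleR_conv_of_real)
  show "dist f g = norm (f - g)" by (rule dist_cdual_def)
  show "(uniformity :: ('a cdual \<times> 'a cdual) filter) = (INF e\<in>{0 <..}. principal {(x, y). dist x y < e})"
    by (rule uniformity_cdual_def)
  show "open S = (\<forall>x\<in>S. \<forall>\<^sub>F (x', y) in uniformity. x' = x \<longrightarrow> y \<in> S)" for S :: "'a cdual set"
    by (rule open_cdual_def)
  show "sgn f = inverse (norm f) *\<^sub>R f" by (rule sgn_cdual_def)
  show "(norm f = 0) = (f = 0)" by transfer simp
  show "norm (f + g) \<le> norm f + norm g" by transfer (rule norm_triangle_ineq)
  show "norm (r *\<^sub>R f) = \<bar>r\<bar> * norm f" by transfer simp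
  show "norm (c *\<^sub>C f) = cmod c * norm f"
    by transfer (rule norm_Blinfun_cmult)
qed

end


lemma cdual_eqI: "(\<And>x. cdual_apply f x = cdual_apply g x) \<Longrightarrow> f = g"
  by transfer (rule blinfun_eqI)

lemma cdual_apply_simps:
  "cdual_apply 0 x = 0"
  "cdual_apply (f + g) x = cdual_apply f x + cdual_apply g x"
  "cdual_apply (f - g) x = cdual_apply f x - cdual_apply g x"
  "cdual_apply (- f) x = - cdual_apply f x"
  "cdual_apply (r *\<^sub>R f) x = r *\<^sub>R cdual_apply f x"
  "cdual_apply (c *\<^sub>C f) x = c * cdual_apply f x"
  by (transfer, simp add: blinfun.bilinear_simps Blinfun_cmult_apply)+

lemma bounded_clinear_cdual_apply: "bounded_clinear (cdual_apply f)"
  unfolding bounded_clinear_def scaleC_complex_def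
  by transfer (simp add: blinfun.bounded_linear_right)

lemma cdual_apply_CDual: "bounded_clinear f \<Longrightarrow> cdual_apply (CDual f) x = f x"
  by (simp add: cdual_apply.rep_eq CDual_def Abs_cdual_inverse bounded_clinear_def
      bounded_linear_Blinfun_apply scaleC_complex_def)

lemma norm_cdual_apply: "cmod (cdual_apply f x) \<le> norm f * norm x"
  by transfer (rule norm_blinfun)

lemma norm_cdual_bound:
  "0 \<le> b \<Longrightarrow> (\<And>x. cmod (cdual_apply f x) \<le> b * norm x) \<Longrightarrow> norm f \<le> b"
  by transfer (rule norm_blinfun_bound)

lemma norm_cdual_eq_onorm: "norm f = onorm (cdual_apply f)"
  by transfer (rule norm_blinfun.rep_eq)

instance cdual :: (complex_normed_vector) complex_banach
proof
  fix X :: "nat \<Rightarrow> 'a cdual"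
  assume X: "Cauchy X"
  have norm_Rep: "norm (Rep_cdual f) = norm f" for f :: "'a cdual"
    by (simp add: norm_cdual.rep_eq)
  have Rep_diff: "Rep_cdual (f - g) = Rep_cdual f - Rep_cdual g" for f g :: "'a cdual"
    by (simp add: minus_cdual.rep_eq)
  have "Cauchy (\<lambda>n. Rep_cdual (X n))"
    using X by (simp add: Cauchy_iff flip: Rep_diff norm_Rep)
  then obtain F where F: "(\<lambda>n. Rep_cdual (X n)) \<longlonglongrightarrow> F"
    using Cauchy_convergent convergent_def by blast
  have lim: "(\<lambda>n. Rep_cdual (X n) x) \<longlonglongrightarrow> F x" for x
    by (intro blinfun.tendsto F tendsto_const)
  have "F (c *\<^sub>C x) = c * F x" for c x
  proof (rule LIMSEQ_unique[OF lim])
    have "Rep_cdual (X n) (c *\<^sub>C x) = c * Rep_cdual (X n) x" for n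
      using Rep_cdual[of "X n"] by simp
    then show "(\<lambda>n. Rep_cdual (X n) (c *\<^sub>C x)) \<longlonglongrightarrow> c * F x"
      by (simp add: tendsto_mult_left lim)
  qed
  then have RF: "Rep_cdual (Abs_cdual F) = F"
    by (simp add: Abs_cdual_inverse)
  have "X \<longlonglongrightarrow> Abs_cdual F"
    using F by (simp add: LIMSEQ_iff RF Rep_diff flip: norm_Rep)
  then show "convergent X"
    by (auto simp: convergent_def)
qed

definition cadjoint ::
    "('x::complex_normed_vector \<Rightarrow> 'y::complex_normed_vector) \<Rightarrow> 'y cdual \<Rightarrow> 'x cdual" where
  "cadjoint T f = CDual (\<lambda>x. cdual_apply f (T x))"

definition bidual_embed :: "'x::complex_normed_vector \<Rightarrow> 'x cdual cdual" where
  "bidual_embed x = CDual (\<lambda>f. cdual_apply f x)"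


section \<open>The algebraic tensor product\<close>

text \<open>The elementary tensor of \<open>a\<close> and \<open>b\<close> is evaluation at \<open>(a, b)\<close> on the space of all
  (not necessarily bounded) bilinear forms; the algebraic tensor product consists of the finite
  sums of these evaluations.\<close>

definition eval_pairs ::
    "('a::complex_vector \<times> 'b::complex_vector) list \<Rightarrow> ('a \<Rightarrow> 'b \<Rightarrow> complex) \<Rightarrow> complex" where
  "eval_pairs ps \<phi> = (if cbilinear \<phi> then \<Sum>(a, b)\<leftarrow>ps. \<phi> a b else 0)"

typedef (overloaded) ('a, 'b) tensor =
    "range (eval_pairs :: ('a::complex_vector \<times> 'b::complex_vector) list \<Rightarrow> _)"
  by blast

setup_lifting type_definition_tensor

lemma eval_pairs_append: "eval_pairs (ps @ qs) \<phi> = eval_pairs ps \<phi> + eval_pairs qs \<phi>"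
  by (simp add: eval_pairs_def)

lemma sum_list_scale_pairs:
  assumes "cbilinear B"
  shows "(\<Sum>(a, b)\<leftarrow>map (\<lambda>(a, b). (c *\<^sub>C a, b)) ps. B a b) = c *\<^sub>C (\<Sum>(a, b)\<leftarrow>ps. B a b)"
proof (induction ps)
  case (Cons p ps)
  then show ?case
    using assms by (cases p) (simp add: cbilinear_def scaleC_add_right)
qed simp

lemma eval_pairs_scale: "eval_pairs (map (\<lambda>(a, b). (c *\<^sub>C a, b)) ps) \<phi> = c * eval_pairs ps \<phi>"
  using sum_list_scale_pairs[of \<phi> c ps] by (simp add: eval_pairs_def scaleC_complex_def)

lemma tensor_closed_add:
  assumes "f \<in> range eval_pairs" "g \<in> range eval_pairs"
  shows "(\<lambda>\<phi>. f \<phi> + g \<phi>) \<in> range eval_pairs"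
proof -
  obtain ps qs where "f = eval_pairs ps" "g = eval_pairs qs" using assms by auto
  then have "(\<lambda>\<phi>. f \<phi> + g \<phi>) = eval_pairs (ps @ qs)" by (simp add: eval_pairs_append fun_eq_iff)
  then show ?thesis by simp
qed

lemma tensor_closed_scale:
  assumes "f \<in> range eval_pairs"
  shows "(\<lambda>\<phi>. c * f \<phi>) \<in> range eval_pairs"
proof -
  obtain ps where "f = eval_pairs ps" using assms by auto
  then have "(\<lambda>\<phi>. c * f \<phi>) = eval_pairs (map (\<lambda>(a, b). (c *\<^sub>C a, b)) ps)"
    by (simp add: eval_pairs_scale fun_eq_iff)
  then show ?thesis by simp
qed

instantiation tensor :: (complex_vector, complex_vector) complex_vector
begin

lift_definition zero_tensor :: "('a, 'b) tensor" is "\<lambda>\<phi>. 0"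
  by (rule image_eqI[of _ _ "[]"]) (auto simp: eval_pairs_def)
lift_definition plus_tensor :: "('a, 'b) tensor \<Rightarrow> ('a, 'b) tensor \<Rightarrow> ('a, 'b) tensor"
  is "\<lambda>f g \<phi>. f \<phi> + g \<phi>" by (rule tensor_closed_add)
lift_definition scaleC_tensor :: "complex \<Rightarrow> ('a, 'b) tensor \<Rightarrow> ('a, 'b) tensor"
  is "\<lambda>c f \<phi>. c * f \<phi>" by (rule tensor_closed_scale)
definition scaleR_tensor :: "real \<Rightarrow> ('a, 'b) tensor \<Rightarrow> ('a, 'b) tensor" where
  "scaleR_tensor r t = scaleC (of_real r) t"
definition uminus_tensor :: "('a, 'b) tensor \<Rightarrow> ('a, 'b) tensor" where
  "uminus_tensor t = scaleC (-1) t"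
definition minus_tensor :: "('a, 'b) tensor \<Rightarrow> ('a, 'b) tensor \<Rightarrow> ('a, 'b) tensor" where
  "minus_tensor s t = s + - t"

instance
proof
  fix s t u :: "('a, 'b) tensor" and c d :: complex and q r :: real
  show "s + t + u = s + (t + u)" by transfer (simp add: add.assoc)
  show "s + t = t + s" by transfer (simp add: add.commute)
  show "0 + s = s" by transfer simp
  show "- s + s = 0" unfolding uminus_tensor_def by transfer simp
  show "s - t = s + - t" by (rule minus_tensor_def)
  show "c *\<^sub>C (s + t) = c *\<^sub>C s + c *\<^sub>C t" by transfer (simp add: algebra_simps)
  show "(c + d) *\<^sub>C s = c *\<^sub>C s + d *\<^sub>C s" by transfer (simp add: algebra_simps)
  show "c *\<^sub>C d *\<^sub>C s = (c * d) *\<^sub>C s" by transfer (simp add: algebra_simps)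
  show "1 *\<^sub>C s = s" by transfer simp
  show "of_real r *\<^sub>C s = r *\<^sub>R s" by (simp add: scaleR_tensor_def)
  show "r *\<^sub>R (s + t) = r *\<^sub>R s + r *\<^sub>R t"
    unfolding scaleR_tensor_def by transfer (simp add: algebra_simps)
  show "(q + r) *\<^sub>R s = q *\<^sub>R s + r *\<^sub>R s"
    unfolding scaleR_tensor_def by transfer (simp add: algebra_simps)
  show "q *\<^sub>R r *\<^sub>R s = (q * r) *\<^sub>R s"
    unfolding scaleR_tensor_def by transfer (simp add: algebra_simps)
  show "1 *\<^sub>R s = s"
    unfolding scaleR_tensor_def by transfer simp
qed

end

lift_definition etens :: "'a::complex_vector \<Rightarrow> 'b::complex_vector \<Rightarrow> ('a, 'b) tensor"
  is "\<lambda>a b. eval_pairs [(a, b)]"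
  by simp

definition tensor_of :: "('a::complex_vector \<times> 'b::complex_vector) list \<Rightarrow> ('a, 'b) tensor" where
  "tensor_of ps = (\<Sum>(a, b)\<leftarrow>ps. etens a b)"

lemma Rep_tensor_of: "Rep_tensor (tensor_of ps) = eval_pairs ps"
proof (induction ps)
  case Nil
  show ?case by (simp add: tensor_of_def zero_tensor.rep_eq eval_pairs_def fun_eq_iff)
next
  case (Cons p ps)
  then have "Rep_tensor (tensor_of (p # ps)) = (\<lambda>\<phi>. eval_pairs [p] \<phi> + eval_pairs ps \<phi>)"
    by (cases p) (simp add: tensor_of_def plus_tensor.rep_eq etens.rep_eq)
  then show ?case
    using eval_pairs_append[of "[p]" ps] by (simp add: fun_eq_iff)
qed

lemma tensor_of_surj: obtains ps where "t = tensor_of ps"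
proof -
  obtain ps where "Rep_tensor t = eval_pairs ps" using Rep_tensor[of t] by auto
  then have "t = tensor_of ps" by (metis Rep_tensor_of Rep_tensor_inject)
  then show ?thesis by (rule that)
qed

lemma tensor_of_append: "tensor_of (ps @ qs) = tensor_of ps + tensor_of qs"
  by (simp add: tensor_of_def)

lemma cbilinear_etens: "cbilinear etens"
  unfolding cbilinear_def
  by (auto; transfer) (auto simp: eval_pairs_def fun_eq_iff cbilinear_def scaleC_complex_def)

lemma tensor_of_scale: "tensor_of (map (\<lambda>(a, b). (c *\<^sub>C a, b)) ps) = c *\<^sub>C tensor_of ps"
  unfolding tensor_of_def by (rule sum_list_scale_pairs[OF cbilinear_etens])

lemma separating_clinear_functional:
  fixes v :: "'c::complex_vector"
  assumes "v \<noteq> 0"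
  obtains g :: "'c \<Rightarrow> complex"
  where "\<And>x y. g (x + y) = g x + g y" "\<And>c x. g (c *\<^sub>C x) = c * g x" "g v = 1"
proof -
  interpret vector_space_pair "scaleC :: complex \<Rightarrow> 'c \<Rightarrow> 'c" "scaleC :: complex \<Rightarrow> complex \<Rightarrow> complex"
    by (simp add: vector_space_pair_def vector_space_scaleC)
  have "vs1.independent {v}"
    using assms by simp
  from linear_independent_extend[OF this, of "\<lambda>_. 1"] obtain g
    where g: "Vector_Spaces.linear scaleC scaleC g" "g v = (1 :: complex)" by auto
  interpret g: Vector_Spaces.linear scaleC scaleC g by (rule g)
  show ?thesis
    by (rule that[of g]) (simp_all add: g g.add g.scale flip: scaleC_complex_def)
qed

lemma tensor_of_eq_imp_sum_eq:
  assumes B: "cbilinear (B :: 'a::complex_vector \<Rightarrow> 'b::complex_vector \<Rightarrow> 'c::complex_vector)"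
    and eq: "tensor_of ps = tensor_of qs"
  shows "(\<Sum>(a, b)\<leftarrow>ps. B a b) = (\<Sum>(a, b)\<leftarrow>qs. B a b)"
proof (rule ccontr)
  let ?S = "\<lambda>ps. \<Sum>(a, b)\<leftarrow>ps. B a b"
  assume "?S ps \<noteq> ?S qs"
  then have "?S ps - ?S qs \<noteq> 0" by simp
  then obtain g :: "'c \<Rightarrow> complex" where g: "\<And>x y. g (x + y) = g x + g y"
      "\<And>c x. g (c *\<^sub>C x) = c * g x" "g (?S ps - ?S qs) = 1"
    using separating_clinear_functional[of "?S ps - ?S qs" thesis] by blast
  have g0: "g 0 = 0" using g(2)[of 0 0] by simp
  have gS: "g (?S rs) = (\<Sum>(a, b)\<leftarrow>rs. g (B a b))" for rs
    by (induction rs) (auto simp: g g0)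
  have gB: "cbilinear (\<lambda>a b. g (B a b))"
    using B by (simp add: cbilinear_def g scaleC_complex_def)
  have "eval_pairs ps = eval_pairs qs"
    using eq by (metis Rep_tensor_of)
  then have "eval_pairs ps (\<lambda>a b. g (B a b)) = eval_pairs qs (\<lambda>a b. g (B a b))"
    by simp
  then have "g (?S ps) = g (?S qs)" by (simp add: eval_pairs_def gB gS)
  moreover have "g (?S ps) = g (?S ps - ?S qs) + g (?S qs)" by (simp flip: g(1))
  ultimately show False using g(3) by simp
qed

definition tensor_lift ::
    "('a::complex_vector \<Rightarrow> 'b::complex_vector \<Rightarrow> 'c::complex_vector) \<Rightarrow> ('a, 'b) tensor \<Rightarrow> 'c" where
  "tensor_lift B t = (\<Sum>(a, b)\<leftarrow>(SOME ps. t = tensor_of ps). B a b)"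

lemma tensor_lift_tensor_of:
  assumes "cbilinear B"
  shows "tensor_lift B (tensor_of ps) = (\<Sum>(a, b)\<leftarrow>ps. B a b)"
  unfolding tensor_lift_def
  by (rule tensor_of_eq_imp_sum_eq[OF assms]) (metis (mono_tags) someI)

lemma tensor_lift_add:
  assumes "cbilinear B"
  shows "tensor_lift B (s + t) = tensor_lift B s + tensor_lift B t"
proof -
  obtain ps qs where "s = tensor_of ps" "t = tensor_of qs" by (metis tensor_of_surj)
  then show ?thesis
    by (simp add: tensor_lift_tensor_of[OF assms] flip: tensor_of_append)
qed

lemma tensor_lift_scaleC:
  assumes "cbilinear B"
  shows "tensor_lift B (c *\<^sub>C t) = c *\<^sub>C tensor_lift B t"
proof -
  obtain ps where "t = tensor_of ps" by (metis tensor_of_surj)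
  then show ?thesis
    by (simp only: tensor_lift_tensor_of[OF assms] sum_list_scale_pairs[OF assms] flip: tensor_of_scale)
qed

lemma tensor_lift_diff:
  assumes "cbilinear B"
  shows "tensor_lift B (s - t) = tensor_lift B s - tensor_lift B t"
  using tensor_lift_add[OF assms, of "s - t" t] by simp

lemma tensor_lift_etens:
  assumes "cbilinear B"
  shows "tensor_lift B (etens a b) = B a b"
  using tensor_lift_tensor_of[OF assms, of "[(a, b)]"] by (simp add: tensor_of_def)

section \<open>The projective tensor product\<close>

definition proj_norm :: "('a::complex_normed_vector, 'b::complex_normed_vector) tensor \<Rightarrow> real" where
  "proj_norm t = Inf {\<Sum>(a, b)\<leftarrow>ps. norm a * norm b | ps. t = tensor_of ps}"

lemma pair_weight_nonneg: "0 \<le> (\<Sum>(a, b)\<leftarrow>ps. norm a * norm b)"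
  by (induction ps) auto

lemma proj_norm_le: "proj_norm (tensor_of ps) \<le> (\<Sum>(a, b)\<leftarrow>ps. norm a * norm b)"
  unfolding proj_norm_def
  by (rule cInf_lower) (auto intro!: bdd_belowI[of _ 0] pair_weight_nonneg)

lemma proj_norm_greatest:
  assumes "\<And>ps. t = tensor_of ps \<Longrightarrow> z \<le> (\<Sum>(a, b)\<leftarrow>ps. norm a * norm b)"
  shows "z \<le> proj_norm t"
  unfolding proj_norm_def
proof (rule cInf_greatest)
  show "{\<Sum>(a, b)\<leftarrow>ps. norm a * norm b | ps. t = tensor_of ps} \<noteq> {}"
    by (rule tensor_of_surj[of t]) blast
qed (use assms in blast)

lemma proj_norm_nonneg: "0 \<le> proj_norm t"
  by (rule proj_norm_greatest) (rule pair_weight_nonneg)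

lemma proj_norm_near:
  assumes "0 < e"
  obtains ps where "t = tensor_of ps" "(\<Sum>(a, b)\<leftarrow>ps. norm a * norm b) < proj_norm t + e"
proof -
  have "\<exists>ps. t = tensor_of ps \<and> (\<Sum>(a, b)\<leftarrow>ps. norm a * norm b) < proj_norm t + e"
  proof (rule ccontr)
    assume "\<not> ?thesis"
    then have "proj_norm t + e \<le> proj_norm t"
      by (intro proj_norm_greatest) (auto simp: not_less)
    then show False using assms by simp
  qed
  then show ?thesis using that by blast
qed

lemma proj_norm_add: "proj_norm (s + t) \<le> proj_norm s + proj_norm t"
proof (rule field_le_epsilon)
  fix e :: real assume "0 < e"
  then have "0 < e / 2" by simp
  obtain ps where ps: "s = tensor_of ps" "(\<Sum>(a, b)\<leftarrow>ps. norm a * norm b) < proj_norm s + e / 2"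
    by (rule proj_norm_near[OF \<open>0 < e / 2\<close>])
  obtain qs where qs: "t = tensor_of qs" "(\<Sum>(a, b)\<leftarrow>qs. norm a * norm b) < proj_norm t + e / 2"
    by (rule proj_norm_near[OF \<open>0 < e / 2\<close>])
  have "proj_norm (s + t) \<le> (\<Sum>(a, b)\<leftarrow>ps @ qs. norm a * norm b)"
    unfolding ps(1) qs(1) by (subst tensor_of_append[symmetric]) (rule proj_norm_le)
  then show "proj_norm (s + t) \<le> proj_norm s + proj_norm t + e"
    using ps(2) qs(2) by simp
qed

lemma proj_norm_scaleC_le: "proj_norm (c *\<^sub>C t) \<le> cmod c * proj_norm t"
proof (cases "c = 0")
  case True
  have "proj_norm (tensor_of [] :: ('a, 'b) tensor) \<le> 0"
    using proj_norm_le[of "[]"] by simp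
  then show ?thesis using True by (simp add: tensor_of_def)
next
  case False
  have "proj_norm (c *\<^sub>C t) / cmod c \<le> proj_norm t"
  proof (rule proj_norm_greatest)
    fix ps assume t: "t = tensor_of ps"
    have "(\<Sum>(a, b)\<leftarrow>map (\<lambda>(a, b). (c *\<^sub>C a, b)) ps. norm a * norm b) =
        cmod c * (\<Sum>(a, b)\<leftarrow>ps. norm a * norm b)"
      by (induction ps) (auto simp: norm_scaleC algebra_simps)
    then have "proj_norm (c *\<^sub>C t) \<le> cmod c * (\<Sum>(a, b)\<leftarrow>ps. norm a * norm b)"
      using proj_norm_le[of "map (\<lambda>(a, b). (c *\<^sub>C a, b)) ps"] unfolding t tensor_of_scale by simp
    then show "proj_norm (c *\<^sub>C t) / cmod c \<le> (\<Sum>(a, b)\<leftarrow>ps. norm a * norm b)"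
      using False by (simp add: field_simps)
  qed
  then show ?thesis using False by (simp add: field_simps)
qed

lemma proj_norm_scaleC: "proj_norm (c *\<^sub>C t) = cmod c * proj_norm t"
proof (cases "c = 0")
  case True
  then show ?thesis
    using proj_norm_scaleC_le[of c t] proj_norm_nonneg[of "c *\<^sub>C t"] by simp
next
  case False
  have "proj_norm t \<le> cmod (inverse c) * proj_norm (c *\<^sub>C t)"
    using proj_norm_scaleC_le[of "inverse c" "c *\<^sub>C t"] False by (simp add: scaleC_scaleC scaleC_one)
  then have "cmod c * proj_norm t \<le> proj_norm (c *\<^sub>C t)"
    using False by (simp add: norm_divide field_simps)
  then show ?thesis using proj_norm_scaleC_le[of c t] by simp
qed

lemma proj_norm_zero [simp]: "proj_norm 0 = 0"
  using proj_norm_scaleC[of 0 0] by simp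

lemma proj_norm_minus: "proj_norm (- t) = proj_norm t"
  using proj_norm_scaleC[of "-1" t] by (simp add: scaleC_minus1)

lemma proj_norm_diff_commute: "proj_norm (s - t) = proj_norm (t - s)"
  using proj_norm_minus[of "s - t"] by simp

lemma proj_norm_diff_triangle: "proj_norm (s - u) \<le> proj_norm (s - t) + proj_norm (t - u)"
  using proj_norm_add[of "s - t" "t - u"] by simp

lemma proj_norm_diff_le: "\<bar>proj_norm s - proj_norm t\<bar> \<le> proj_norm (s - t)"
  using proj_norm_add[of "s - t" t] proj_norm_add[of "t - s" s] proj_norm_diff_commute[of s t]
  by simp

lemma proj_norm_etens: "proj_norm (etens a b) \<le> norm a * norm b"
  using proj_norm_le[of "[(a, b)]"] by (simp add: tensor_of_def)

lemma tensor_lift_bounded: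
  assumes "cbilinear B" and K: "\<And>a b. norm (B a b) \<le> K * (norm a * norm b)" and "0 \<le> K"
  shows "norm (tensor_lift B t) \<le> K * proj_norm t"
proof (rule field_le_epsilon)
  fix e :: real assume e: "0 < e"
  then have "0 < e / (K + 1)" using \<open>0 \<le> K\<close> by simp
  then obtain ps where ps: "t = tensor_of ps"
      "(\<Sum>(a, b)\<leftarrow>ps. norm a * norm b) < proj_norm t + e / (K + 1)"
    by (rule proj_norm_near)
  have "norm (\<Sum>(a, b)\<leftarrow>ps. B a b) \<le> K * (\<Sum>(a, b)\<leftarrow>ps. norm a * norm b)"
  proof (induction ps)
    case (Cons p ps)
    obtain a b where p: "p = (a, b)" by (cases p)
    show ?case
      using norm_triangle_ineq[of "B a b" "\<Sum>(a, b)\<leftarrow>ps. B a b"] Cons K[of a b]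
      by (simp add: p algebra_simps)
  qed simp
  also have "\<dots> \<le> K * (proj_norm t + e / (K + 1))"
    using ps(2) \<open>0 \<le> K\<close> by (intro mult_left_mono) auto
  also have "\<dots> \<le> K * proj_norm t + e"
    using \<open>0 \<le> K\<close> e by (simp add: field_simps)
  finally show "norm (tensor_lift B t) \<le> K * proj_norm t + e"
    by (simp add: ps(1) tensor_lift_tensor_of[OF assms(1)])
qed


text \<open>The completion consists of Cauchy sequences modulo null sequences; only the seminorm
  properties of \<^const>\<open>proj_norm\<close> are needed to form it.\<close>

definition proj_Cauchy ::
    "(nat \<Rightarrow> ('a::complex_normed_vector, 'b::complex_normed_vector) tensor) \<Rightarrow> bool" where
  "proj_Cauchy U \<longleftrightarrow> (\<forall>e>0. \<exists>N. \<forall>m\<ge>N. \<forall>n\<ge>N. proj_norm (U m - U n) < e)"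

definition ptensor_rel ::
    "(nat \<Rightarrow> ('a::complex_normed_vector, 'b::complex_normed_vector) tensor) \<Rightarrow>
     (nat \<Rightarrow> ('a, 'b) tensor) \<Rightarrow> bool" where
  "ptensor_rel U V \<longleftrightarrow> proj_Cauchy U \<and> proj_Cauchy V \<and> (\<lambda>n. proj_norm (U n - V n)) \<longlonglongrightarrow> 0"

lemma proj_Cauchy_const [simp]: "proj_Cauchy (\<lambda>n. t)"
  by (simp add: proj_Cauchy_def)

lemma proj_Cauchy_add [simp]:
  assumes "proj_Cauchy U" "proj_Cauchy V"
  shows "proj_Cauchy (\<lambda>n. U n + V n)"
  unfolding proj_Cauchy_def
proof (intro allI impI)
  fix e :: real assume "0 < e"
  then have "0 < e / 2" by simp
  obtain M where M: "\<And>m n. M \<le> m \<Longrightarrow> M \<le> n \<Longrightarrow> proj_norm (U m - U n) < e / 2"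
    using assms(1) \<open>0 < e / 2\<close> unfolding proj_Cauchy_def by blast
  obtain N where N: "\<And>m n. N \<le> m \<Longrightarrow> N \<le> n \<Longrightarrow> proj_norm (V m - V n) < e / 2"
    using assms(2) \<open>0 < e / 2\<close> unfolding proj_Cauchy_def by blast
  have "proj_norm ((U m + V m) - (U n + V n)) < e" if "max M N \<le> m" "max M N \<le> n" for m n
    using proj_norm_add[of "U m - U n" "V m - V n"] M[of m n] N[of m n] that
    by (simp add: algebra_simps)
  then show "\<exists>N. \<forall>m\<ge>N. \<forall>n\<ge>N. proj_norm ((U m + V m) - (U n + V n)) < e"
    by blast
qed

lemma proj_Cauchy_scaleC [simp]:
  assumes "proj_Cauchy U"
  shows "proj_Cauchy (\<lambda>n. c *\<^sub>C U n)"
  unfolding proj_Cauchy_def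
proof (intro allI impI)
  fix e :: real assume "0 < e"
  then have "0 < e / (cmod c + 1)" by (simp add: add_nonneg_pos)
  then obtain N where N: "\<And>m n. N \<le> m \<Longrightarrow> N \<le> n \<Longrightarrow> proj_norm (U m - U n) < e / (cmod c + 1)"
    using assms unfolding proj_Cauchy_def by blast
  have "proj_norm (c *\<^sub>C U m - c *\<^sub>C U n) < e" if "N \<le> m" "N \<le> n" for m n
  proof -
    have "cmod c * proj_norm (U m - U n) \<le> (cmod c + 1) * proj_norm (U m - U n)"
      by (simp add: mult_right_mono proj_norm_nonneg)
    also have "\<dots> < e"
      using N[OF that] by (simp add: add_nonneg_pos pos_less_divide_eq mult.commute)
    finally show ?thesis by (simp add: proj_norm_scaleC flip: scaleC_diff_right)
  qed
  then show "\<exists>N. \<forall>m\<ge>N. \<forall>n\<ge>N. proj_norm (c *\<^sub>C U m - c *\<^sub>C U n) < e"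
    by blast
qed

lemma proj_Cauchy_convergent:
  assumes "proj_Cauchy U"
  shows "convergent (\<lambda>n. proj_norm (U n))"
proof (rule Cauchy_convergent, rule CauchyI)
  fix e :: real assume "0 < e"
  then obtain N where "\<And>m n. N \<le> m \<Longrightarrow> N \<le> n \<Longrightarrow> proj_norm (U m - U n) < e"
    using assms unfolding proj_Cauchy_def by blast
  then have "\<forall>m\<ge>N. \<forall>n\<ge>N. norm (proj_norm (U m) - proj_norm (U n)) < e"
    using proj_norm_diff_le order_le_less_trans by (metis real_norm_def)
  then show "\<exists>N. \<forall>m\<ge>N. \<forall>n\<ge>N. norm (proj_norm (U m) - proj_norm (U n)) < e"
    by blast
qed

lemma ptensor_rel_refl: "ptensor_rel U U \<longleftrightarrow> proj_Cauchy U"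
  by (simp add: ptensor_rel_def)

lemma proj_null_le:
  assumes "(\<lambda>n. f n) \<longlonglongrightarrow> (0 :: real)" "\<And>n. proj_norm (U n) \<le> f n"
  shows "(\<lambda>n. proj_norm (U n)) \<longlonglongrightarrow> 0"
  by (rule tendsto_sandwich[OF _ _ tendsto_const assms(1)])
    (simp_all add: proj_norm_nonneg assms(2))

quotient_type (overloaded) ('a, 'b) ptensor =
    "nat \<Rightarrow> ('a::complex_normed_vector, 'b::complex_normed_vector) tensor" / partial: ptensor_rel
proof (rule part_equivpI)
  let ?R = "ptensor_rel :: (nat \<Rightarrow> ('a, 'b) tensor) \<Rightarrow> _"
  show "\<exists>U. ?R U U"
    by (rule exI[of _ "\<lambda>_. 0"]) (simp add: ptensor_rel_refl)
  show "symp ?R"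
    by (rule sympI) (simp add: ptensor_rel_def proj_norm_diff_commute)
  show "transp ?R"
  proof (rule transpI)
    fix U V W :: "nat \<Rightarrow> ('a, 'b) tensor"
    assume UV: "ptensor_rel U V" and VW: "ptensor_rel V W"
    have "(\<lambda>n. proj_norm (U n - V n) + proj_norm (V n - W n)) \<longlonglongrightarrow> 0 + 0"
      using UV VW by (intro tendsto_add) (simp_all add: ptensor_rel_def)
    then have "(\<lambda>n. proj_norm (U n - W n)) \<longlonglongrightarrow> 0"
      by (intro proj_null_le[OF _ proj_norm_diff_triangle]) simp
    then show "ptensor_rel U W"
      using UV VW by (simp add: ptensor_rel_def)
  qed
qed

instantiation ptensor :: (complex_normed_vector, complex_normed_vector) complex_normed_vector
begin

lift_definition zero_ptensor :: "('a, 'b) ptensor" is "\<lambda>n. 0"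
  by (simp add: ptensor_rel_refl)
lift_definition plus_ptensor :: "('a, 'b) ptensor \<Rightarrow> ('a, 'b) ptensor \<Rightarrow> ('a, 'b) ptensor"
  is "\<lambda>U V n. U n + V n"
proof -
  fix U U' V V' :: "nat \<Rightarrow> ('a, 'b) tensor"
  assume U: "ptensor_rel U U'" and V: "ptensor_rel V V'"
  have "(\<lambda>n. proj_norm (U n - U' n) + proj_norm (V n - V' n)) \<longlonglongrightarrow> 0 + 0"
    using U V by (intro tendsto_add) (simp_all add: ptensor_rel_def)
  then have "(\<lambda>n. proj_norm ((U n - U' n) + (V n - V' n))) \<longlonglongrightarrow> 0"
    by (intro proj_null_le[OF _ proj_norm_add]) simp
  then show "ptensor_rel (\<lambda>n. U n + V n) (\<lambda>n. U' n + V' n)"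
    using U V by (simp add: ptensor_rel_def algebra_simps)
qed
lift_definition scaleC_ptensor :: "complex \<Rightarrow> ('a, 'b) ptensor \<Rightarrow> ('a, 'b) ptensor"
  is "\<lambda>c U n. c *\<^sub>C U n"
proof -
  fix c and U U' :: "nat \<Rightarrow> ('a, 'b) tensor"
  assume U: "ptensor_rel U U'"
  then have "(\<lambda>n. cmod c * proj_norm (U n - U' n)) \<longlonglongrightarrow> cmod c * 0"
    by (intro tendsto_mult tendsto_const) (simp add: ptensor_rel_def)
  then show "ptensor_rel (\<lambda>n. c *\<^sub>C U n) (\<lambda>n. c *\<^sub>C U' n)"
    using U by (simp add: ptensor_rel_def proj_norm_scaleC flip: scaleC_diff_right)
qed
definition scaleR_ptensor :: "real \<Rightarrow> ('a, 'b) ptensor \<Rightarrow> ('a, 'b) ptensor" where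
  "scaleR_ptensor r u = scaleC (of_real r) u"
definition uminus_ptensor :: "('a, 'b) ptensor \<Rightarrow> ('a, 'b) ptensor" where
  "uminus_ptensor u = scaleC (-1) u"
definition minus_ptensor :: "('a, 'b) ptensor \<Rightarrow> ('a, 'b) ptensor \<Rightarrow> ('a, 'b) ptensor" where
  "minus_ptensor u v = u + - v"
lift_definition norm_ptensor :: "('a, 'b) ptensor \<Rightarrow> real" is "\<lambda>U. lim (\<lambda>n. proj_norm (U n))"
proof -
  fix U V :: "nat \<Rightarrow> ('a, 'b) tensor"
  assume UV: "ptensor_rel U V"
  then have U: "(\<lambda>n. proj_norm (U n)) \<longlonglongrightarrow> lim (\<lambda>n. proj_norm (U n))"
    using proj_Cauchy_convergent convergent_LIMSEQ_iff by (auto simp: ptensor_rel_def)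
  have "(\<lambda>n. proj_norm (U n) - proj_norm (V n)) \<longlonglongrightarrow> 0"
    by (rule Lim_null_comparison[of _ "\<lambda>n. proj_norm (U n - V n)"])
      (use UV in \<open>simp_all add: ptensor_rel_def proj_norm_diff_le\<close>)
  then have "(\<lambda>n. proj_norm (U n) - (proj_norm (U n) - proj_norm (V n))) \<longlonglongrightarrow>
      lim (\<lambda>n. proj_norm (U n)) - 0"
    by (intro tendsto_diff U)
  then have "(\<lambda>n. proj_norm (V n)) \<longlonglongrightarrow> lim (\<lambda>n. proj_norm (U n))" by simp
  then show "lim (\<lambda>n. proj_norm (U n)) = lim (\<lambda>n. proj_norm (V n))"
    by (simp add: limI)
qed
definition dist_ptensor :: "('a, 'b) ptensor \<Rightarrow> ('a, 'b) ptensor \<Rightarrow> real" where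
  "dist_ptensor u v = norm (u - v)"
definition uniformity_ptensor :: "(('a, 'b) ptensor \<times> ('a, 'b) ptensor) filter" where
  "uniformity_ptensor = (INF e\<in>{0 <..}. principal {(x, y). dist x y < e})"
definition open_ptensor :: "('a, 'b) ptensor set \<Rightarrow> bool" where
  "open_ptensor S = (\<forall>x\<in>S. \<forall>\<^sub>F (x', y) in uniformity. x' = x \<longrightarrow> y \<in> S)"
definition sgn_ptensor :: "('a, 'b) ptensor \<Rightarrow> ('a, 'b) ptensor" where
  "sgn_ptensor u = scaleR (inverse (norm u)) u"

instance
proof
  fix u v w :: "('a, 'b) ptensor" and c d :: complex and q r :: real
  have lim: "(\<lambda>n. proj_norm (U n)) \<longlonglongrightarrow> lim (\<lambda>n. proj_norm (U n))"
    if "ptensor_rel U U" for U :: "nat \<Rightarrow> ('a, 'b) tensor"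
    using that proj_Cauchy_convergent convergent_LIMSEQ_iff by (auto simp: ptensor_rel_def)
  show "u + v + w = u + (v + w)" by transfer (simp add: ptensor_rel_def add.assoc)
  show "u + v = v + u" by transfer (simp add: ptensor_rel_def add.commute)
  show "0 + u = u" by transfer (simp add: ptensor_rel_def)
  show "- u + u = 0"
    unfolding uminus_ptensor_def by transfer (simp add: ptensor_rel_def scaleC_minus1)
  show "u - v = u + - v" by (rule minus_ptensor_def)
  show add: "c *\<^sub>C (u + v) = c *\<^sub>C u + c *\<^sub>C v" for c and u v :: "('a, 'b) ptensor"
    by transfer (simp add: ptensor_rel_def scaleC_add_right)
  show add': "(c + d) *\<^sub>C u = c *\<^sub>C u + d *\<^sub>C u" for c d
    by transfer (simp add: ptensor_rel_def scaleC_add_left)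
  show mult: "c *\<^sub>C d *\<^sub>C u = (c * d) *\<^sub>C u" for c d
    by transfer (simp add: ptensor_rel_def scaleC_scaleC)
  show one: "1 *\<^sub>C u = u" by transfer (simp add: ptensor_rel_def scaleC_one)
  show "of_real r *\<^sub>C u = r *\<^sub>R u" by (simp add: scaleR_ptensor_def)
  show "r *\<^sub>R (u + v) = r *\<^sub>R u + r *\<^sub>R v" by (simp add: scaleR_ptensor_def add)
  show "(q + r) *\<^sub>R u = q *\<^sub>R u + r *\<^sub>R u" by (simp add: scaleR_ptensor_def add')
  show "q *\<^sub>R r *\<^sub>R u = (q * r) *\<^sub>R u" by (simp add: scaleR_ptensor_def mult)
  show "1 *\<^sub>R u = u" by (simp add: scaleR_ptensor_def one)
  show "dist u v = norm (u - v)" by (rule dist_ptensor_def)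
  show "(uniformity :: (('a, 'b) ptensor \<times> ('a, 'b) ptensor) filter) =
      (INF e\<in>{0 <..}. principal {(x, y). dist x y < e})"
    by (rule uniformity_ptensor_def)
  show "open S = (\<forall>x\<in>S. \<forall>\<^sub>F (x', y) in uniformity. x' = x \<longrightarrow> y \<in> S)" for S :: "('a, 'b) ptensor set"
    by (rule open_ptensor_def)
  show "sgn u = inverse (norm u) *\<^sub>R u" by (rule sgn_ptensor_def)
  show "(norm u = 0) = (u = 0)"
  proof (transfer)
    fix U :: "nat \<Rightarrow> ('a, 'b) tensor" assume U: "ptensor_rel U U"
    show "(lim (\<lambda>n. proj_norm (U n)) = 0) = ptensor_rel U (\<lambda>n. 0)"
      using lim[OF U] U limI by (auto simp: ptensor_rel_def)
  qed
  show "norm (u + v) \<le> norm u + norm v"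
  proof (transfer)
    fix U V :: "nat \<Rightarrow> ('a, 'b) tensor" assume U: "ptensor_rel U U" and V: "ptensor_rel V V"
    have UV: "ptensor_rel (\<lambda>n. U n + V n) (\<lambda>n. U n + V n)"
      using U V by (simp add: ptensor_rel_def)
    show "lim (\<lambda>n. proj_norm (U n + V n)) \<le> lim (\<lambda>n. proj_norm (U n)) + lim (\<lambda>n. proj_norm (V n))"
      by (rule LIMSEQ_le[OF lim[OF UV] tendsto_add[OF lim[OF U] lim[OF V]]])
        (simp add: proj_norm_add)
  qed
  show norm: "norm (c *\<^sub>C u) = cmod c * norm u" for c
  proof (transfer)
    fix c and U :: "nat \<Rightarrow> ('a, 'b) tensor" assume U: "ptensor_rel U U"
    have "(\<lambda>n. proj_norm (c *\<^sub>C U n)) \<longlonglongrightarrow> cmod c * lim (\<lambda>n. proj_norm (U n))"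
      by (simp add: proj_norm_scaleC tendsto_mult_left lim[OF U])
    then show "lim (\<lambda>n. proj_norm (c *\<^sub>C U n)) = cmod c * lim (\<lambda>n. proj_norm (U n))"
      by (rule limI)
  qed
  show "norm (r *\<^sub>R u) = \<bar>r\<bar> * norm u" by (simp add: scaleR_ptensor_def norm)
qed

end

lemma ptensor_cases:
  obtains U where "proj_Cauchy U" "u = abs_ptensor U"
proof -
  have "\<exists>U. ptensor_rel U U \<and> u = abs_ptensor U"
    by (induction u rule: ptensor.abs_induct) blast
  then show ?thesis using that by (auto simp: ptensor_rel_refl)
qed

lemma abs_ptensor_eqI:
  "proj_Cauchy U \<Longrightarrow> proj_Cauchy V \<Longrightarrow> (\<lambda>n. proj_norm (U n - V n)) \<longlonglongrightarrow> 0 \<Longrightarrow>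
    abs_ptensor U = abs_ptensor V"
  by (rule Quotient_rel_abs[OF Quotient_ptensor]) (simp add: ptensor_rel_def)

lemma abs_ptensor_add:
  "proj_Cauchy U \<Longrightarrow> proj_Cauchy V \<Longrightarrow> abs_ptensor U + abs_ptensor V = abs_ptensor (\<lambda>n. U n + V n)"
  by (simp add: plus_ptensor.abs_eq ptensor_rel_refl)

lemma abs_ptensor_scaleC: "proj_Cauchy U \<Longrightarrow> c *\<^sub>C abs_ptensor U = abs_ptensor (\<lambda>n. c *\<^sub>C U n)"
  by (simp add: scaleC_ptensor.abs_eq ptensor_rel_refl)

lemma abs_ptensor_diff:
  "proj_Cauchy U \<Longrightarrow> proj_Cauchy V \<Longrightarrow> abs_ptensor U - abs_ptensor V = abs_ptensor (\<lambda>n. U n - V n)"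
proof -
  assume U: "proj_Cauchy U" and V: "proj_Cauchy V"
  have "abs_ptensor U - abs_ptensor V = abs_ptensor U + (-1) *\<^sub>C abs_ptensor V"
    by (simp only: minus_ptensor_def uminus_ptensor_def)
  also have "\<dots> = abs_ptensor (\<lambda>n. U n + (-1) *\<^sub>C V n)"
    using U V by (simp only: abs_ptensor_scaleC abs_ptensor_add proj_Cauchy_scaleC)
  finally show ?thesis by (simp add: scaleC_minus1)
qed

lemma norm_abs_ptensor:
  "proj_Cauchy U \<Longrightarrow> (\<lambda>n. proj_norm (U n)) \<longlonglongrightarrow> norm (abs_ptensor U)"
  using proj_Cauchy_convergent convergent_LIMSEQ_iff
  by (auto simp: norm_ptensor.abs_eq ptensor_rel_refl)

definition ptensor_embed ::
    "('a::complex_normed_vector, 'b::complex_normed_vector) tensor \<Rightarrow> ('a, 'b) ptensor" where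
  "ptensor_embed t = abs_ptensor (\<lambda>n. t)"

lemma norm_ptensor_embed: "norm (ptensor_embed t) = proj_norm t"
  using norm_abs_ptensor[of "\<lambda>_. t"] by (simp add: ptensor_embed_def LIMSEQ_const_iff)

lemma ptensor_embed_add: "ptensor_embed (s + t) = ptensor_embed s + ptensor_embed t"
  by (simp add: ptensor_embed_def abs_ptensor_add)

lemma ptensor_embed_zero: "ptensor_embed 0 = 0"
  using ptensor_embed_add[of 0 0] by simp

lemma ptensor_embed_diff: "ptensor_embed (s - t) = ptensor_embed s - ptensor_embed t"
  by (simp add: ptensor_embed_def abs_ptensor_diff)

lemma ptensor_embed_scaleC: "ptensor_embed (c *\<^sub>C t) = c *\<^sub>C ptensor_embed t"
  by (simp add: ptensor_embed_def abs_ptensor_scaleC)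

lemma ptensor_embed_tendsto:
  assumes U: "proj_Cauchy U"
  shows "(\<lambda>n. ptensor_embed (U n)) \<longlonglongrightarrow> abs_ptensor U"
proof (rule LIMSEQ_I)
  fix e :: real assume "0 < e"
  then have "0 < e / 2" by simp
  then obtain N where N: "\<And>m n. N \<le> m \<Longrightarrow> N \<le> n \<Longrightarrow> proj_norm (U m - U n) < e / 2"
    using U unfolding proj_Cauchy_def by blast
  have "norm (ptensor_embed (U n) - abs_ptensor U) < e" if "N \<le> n" for n
  proof -
    have UC: "proj_Cauchy (\<lambda>m. U n - U m)"
      using proj_Cauchy_add[OF proj_Cauchy_const[of "U n"] proj_Cauchy_scaleC[OF U, of "-1"]]
      by (simp add: scaleC_minus1)
    have "\<forall>m\<ge>N. proj_norm (U n - U m) \<le> e / 2"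
      using N that by (simp add: less_imp_le)
    then have "norm (abs_ptensor (\<lambda>m. U n - U m)) \<le> e / 2"
      by (intro LIMSEQ_le_const2[OF norm_abs_ptensor[OF UC]]) blast
    moreover have "ptensor_embed (U n) - abs_ptensor U = abs_ptensor (\<lambda>m. U n - U m)"
      by (simp add: ptensor_embed_def abs_ptensor_diff U)
    ultimately show ?thesis using \<open>0 < e\<close> by simp
  qed
  then show "\<exists>N. \<forall>n\<ge>N. norm (ptensor_embed (U n) - abs_ptensor U) < e" by blast
qed

lemma proj_Cauchy_iff: "proj_Cauchy U \<longleftrightarrow> Cauchy (\<lambda>n. ptensor_embed (U n))"
  by (simp add: proj_Cauchy_def Cauchy_iff norm_ptensor_embed flip: ptensor_embed_diff)

lemma ptensor_embed_dense:
  assumes "0 < e"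
  obtains t where "norm (u - ptensor_embed t) < e"
proof -
  obtain U where "proj_Cauchy U" "u = abs_ptensor U" by (rule ptensor_cases)
  then have "(\<lambda>n. ptensor_embed (U n)) \<longlonglongrightarrow> u" by (simp add: ptensor_embed_tendsto)
  then obtain n where "norm (ptensor_embed (U n) - u) < e"
    using LIMSEQ_D[OF _ assms] by blast
  then show ?thesis using that by (simp add: norm_minus_commute)
qed

instance ptensor :: (complex_normed_vector, complex_normed_vector) complex_banach
proof
  fix X :: "nat \<Rightarrow> ('a, 'b) ptensor"
  assume X: "Cauchy X"
  have "\<exists>t. norm (X n - ptensor_embed t) < inverse (real (Suc n))" for n
    by (rule ptensor_embed_dense[of "inverse (real (Suc n))" "X n"]) auto
  then obtain T where T: "\<And>n. norm (X n - ptensor_embed (T n)) < inverse (real (Suc n))"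
    by metis
  have D: "(\<lambda>n. X n - ptensor_embed (T n)) \<longlonglongrightarrow> 0"
    by (rule Lim_null_comparison[OF _ LIMSEQ_inverse_real_of_nat])
      (use T in \<open>simp add: less_imp_le del: of_nat_Suc\<close>)
  have "proj_Cauchy T"
    unfolding proj_Cauchy_def
  proof (intro allI impI)
    fix e :: real assume "0 < e"
    then have e: "0 < e / 3" by simp
    obtain M where M: "\<And>m n. M \<le> m \<Longrightarrow> M \<le> n \<Longrightarrow> norm (X m - X n) < e / 3"
      using CauchyD[OF X e] by blast
    obtain N where N: "\<And>n. N \<le> n \<Longrightarrow> norm (X n - ptensor_embed (T n)) < e / 3"
      using LIMSEQ_D[OF D e] by auto
    have "proj_norm (T m - T n) < e" if "max M N \<le> m" "max M N \<le> n" for m n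
    proof -
      have "proj_norm (T m - T n) = norm ((X m - X n) - (X m - ptensor_embed (T m)) + (X n - ptensor_embed (T n)))"
        by (simp add: ptensor_embed_diff flip: norm_ptensor_embed)
      also have "\<dots> \<le> norm (X m - X n) + norm (X m - ptensor_embed (T m)) + norm (X n - ptensor_embed (T n))"
        by (intro order_trans[OF norm_triangle_ineq] add_mono norm_triangle_ineq4 order_refl)
      also have "\<dots> < e" using M[of m n] N[of m] N[of n] that by simp
      finally show ?thesis .
    qed
    then show "\<exists>N. \<forall>m\<ge>N. \<forall>n\<ge>N. proj_norm (T m - T n) < e" by blast
  qed
  then have "(\<lambda>n. (X n - ptensor_embed (T n)) + ptensor_embed (T n)) \<longlonglongrightarrow> 0 + abs_ptensor T"
    by (intro tendsto_add D ptensor_embed_tendsto)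
  then show "convergent X" by (auto simp: convergent_def)
qed

definition ptens ::
    "'a::complex_normed_vector \<Rightarrow> 'b::complex_normed_vector \<Rightarrow> ('a, 'b) ptensor"
    (infixr \<open>\<otimes>\<^sub>p\<close> 70) where
  "a \<otimes>\<^sub>p b = ptensor_embed (etens a b)"

lemma norm_ptens_le: "norm (a \<otimes>\<^sub>p b) \<le> norm a * norm b"
  by (simp add: ptens_def norm_ptensor_embed proj_norm_etens)

lemma cbilinear_ptens: "cbilinear (\<otimes>\<^sub>p)"
  by (simp add: cbilinear_def ptens_def cbilinear_etens[unfolded cbilinear_def]
      ptensor_embed_add ptensor_embed_scaleC)

lemma bounded_clinear_add: "bounded_clinear f \<Longrightarrow> f (x + y) = f x + f y"
  by (simp add: bounded_clinear_def linear_add bounded_linear.linear)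

lemma bounded_clinear_zero: "bounded_clinear f \<Longrightarrow> f 0 = 0"
  by (simp add: bounded_clinear_def linear_0 bounded_linear.linear)

lemma bounded_clinear_tendsto:
  "bounded_clinear f \<Longrightarrow> (u \<longlongrightarrow> l) F \<Longrightarrow> ((\<lambda>x. f (u x)) \<longlongrightarrow> f l) F"
  by (simp add: bounded_clinear_def bounded_linear.tendsto)

lemma bounded_clinear_ptensor_eqI:
  fixes f g :: "('a::complex_normed_vector, 'b::complex_normed_vector) ptensor \<Rightarrow> 'c::complex_normed_vector"
  assumes f: "bounded_clinear f" and g: "bounded_clinear g"
    and eq: "\<And>a b. f (a \<otimes>\<^sub>p b) = g (a \<otimes>\<^sub>p b)"
  shows "f = g"
proof
  fix u :: "('a, 'b) ptensor"
  have emb: "f (ptensor_embed (tensor_of ps)) = g (ptensor_embed (tensor_of ps))" for ps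
  proof (induction ps)
    case Nil
    show ?case
      by (simp add: tensor_of_def ptensor_embed_zero bounded_clinear_zero[OF f] bounded_clinear_zero[OF g])
  next
    case (Cons p ps)
    have "tensor_of (p # ps) = etens (fst p) (snd p) + tensor_of ps"
      by (simp add: tensor_of_def case_prod_beta)
    then show ?case
      using Cons eq by (simp add: ptensor_embed_add bounded_clinear_add[OF f]
        bounded_clinear_add[OF g] flip: ptens_def)
  qed
  then have emb: "f (ptensor_embed t) = g (ptensor_embed t)" for t
    by (metis tensor_of_surj)
  obtain U where U: "proj_Cauchy U" "u = abs_ptensor U" by (rule ptensor_cases)
  have "(\<lambda>n. f (ptensor_embed (U n))) \<longlonglongrightarrow> f u" "(\<lambda>n. f (ptensor_embed (U n))) \<longlonglongrightarrow> g u"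
    unfolding U(2)
    using bounded_clinear_tendsto[OF f ptensor_embed_tendsto[OF U(1)]]
      bounded_clinear_tendsto[OF g ptensor_embed_tendsto[OF U(1)]]
    by (simp_all add: emb)
  then show "f u = g u" by (rule LIMSEQ_unique)
qed

lemma ptensor_universal:
  fixes B :: "'a::complex_normed_vector \<Rightarrow> 'b::complex_normed_vector \<Rightarrow> 'c::complex_banach"
  assumes B: "cbilinear B" and K: "\<And>a b. norm (B a b) \<le> K * (norm a * norm b)" and "0 \<le> K"
  shows "\<exists>f. bounded_clinear f \<and> (\<forall>a b. f (a \<otimes>\<^sub>p b) = B a b) \<and> (\<forall>u. norm (f u) \<le> K * norm u)"
proof -
  note bd = tensor_lift_bounded[OF B K \<open>0 \<le> K\<close>]
  have "\<exists>l. \<forall>U. proj_Cauchy U \<longrightarrow> u = abs_ptensor U \<longrightarrow> (\<lambda>n. tensor_lift B (U n)) \<longlonglongrightarrow> l" for u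
  proof -
    obtain V where V: "proj_Cauchy V" "u = abs_ptensor V" by (rule ptensor_cases)
    have "Cauchy (\<lambda>n. tensor_lift B (V n))"
    proof (rule CauchyI)
      fix e :: real assume e: "0 < e"
      then have "0 < e / (K + 1)" using \<open>0 \<le> K\<close> by simp
      then obtain N where N: "\<And>m n. N \<le> m \<Longrightarrow> N \<le> n \<Longrightarrow> proj_norm (V m - V n) < e / (K + 1)"
        using V(1) unfolding proj_Cauchy_def by blast
      have "norm (tensor_lift B (V m) - tensor_lift B (V n)) < e" if "N \<le> m" "N \<le> n" for m n
      proof -
        have "norm (tensor_lift B (V m) - tensor_lift B (V n)) \<le> K * proj_norm (V m - V n)"
          using bd[of "V m - V n"] by (simp add: tensor_lift_diff[OF B])
        also have "\<dots> \<le> (K + 1) * proj_norm (V m - V n)"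
          by (simp add: mult_right_mono proj_norm_nonneg)
        also have "\<dots> < e"
          using N[OF that] \<open>0 \<le> K\<close> by (simp add: pos_less_divide_eq mult.commute)
        finally show ?thesis .
      qed
      then show "\<exists>N. \<forall>m\<ge>N. \<forall>n\<ge>N. norm (tensor_lift B (V m) - tensor_lift B (V n)) < e" by blast
    qed
    then obtain l where l: "(\<lambda>n. tensor_lift B (V n)) \<longlonglongrightarrow> l"
      using Cauchy_convergent convergent_def by blast
    have "(\<lambda>n. tensor_lift B (U n)) \<longlonglongrightarrow> l" if U: "proj_Cauchy U" "u = abs_ptensor U" for U
    proof -
      have "(\<lambda>n. ptensor_embed (U n) - ptensor_embed (V n)) \<longlonglongrightarrow> u - u"
        using tendsto_diff[OF ptensor_embed_tendsto[OF U(1)] ptensor_embed_tendsto[OF V(1)]]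
        by (simp add: U(2)[symmetric] V(2)[symmetric])
      then have "(\<lambda>n. norm (ptensor_embed (U n - V n))) \<longlonglongrightarrow> 0"
        by (simp add: ptensor_embed_diff tendsto_norm_zero)
      then have "(\<lambda>n. proj_norm (U n - V n)) \<longlonglongrightarrow> 0"
        by (simp add: norm_ptensor_embed)
      then have "(\<lambda>n. K * proj_norm (U n - V n)) \<longlonglongrightarrow> 0"
        by (rule tendsto_mult_right_zero)
      then have "(\<lambda>n. tensor_lift B (U n - V n)) \<longlonglongrightarrow> 0"
        by (rule Lim_null_comparison[rotated]) (simp add: bd)
      from tendsto_add[OF this l] show ?thesis by (simp add: tensor_lift_diff[OF B])
    qed
    then show ?thesis by blast
  qed
  then obtain f where f: "\<And>U. proj_Cauchy U \<Longrightarrow> (\<lambda>n. tensor_lift B (U n)) \<longlonglongrightarrow> f (abs_ptensor U)"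
    by metis
  have f_add: "f (u + v) = f u + f v" for u v
  proof -
    obtain U where U: "proj_Cauchy U" "u = abs_ptensor U" by (rule ptensor_cases)
    obtain V where V: "proj_Cauchy V" "v = abs_ptensor V" by (rule ptensor_cases)
    have "(\<lambda>n. tensor_lift B (U n + V n)) \<longlonglongrightarrow> f u + f v"
      unfolding tensor_lift_add[OF B] U(2) V(2) by (intro tendsto_add f U V)
    moreover have "(\<lambda>n. tensor_lift B (U n + V n)) \<longlonglongrightarrow> f (u + v)"
      unfolding U(2) V(2) abs_ptensor_add[OF U(1) V(1)] by (intro f proj_Cauchy_add U V)
    ultimately show ?thesis by (rule LIMSEQ_unique[symmetric])
  qed
  have f_scaleC: "f (c *\<^sub>C u) = c *\<^sub>C f u" for c u
  proof -
    obtain U where U: "proj_Cauchy U" "u = abs_ptensor U" by (rule ptensor_cases)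
    have bl: "bounded_linear (\<lambda>x :: 'c. c *\<^sub>C x)"
    proof (rule bounded_linear_intro[where K = "cmod c"])
      show "c *\<^sub>C (r *\<^sub>R x) = r *\<^sub>R (c *\<^sub>C x)" for r and x :: 'c
        by (simp add: scaleC_scaleC mult.commute flip: scaleC_of_real)
    qed (simp_all add: scaleC_add_right norm_scaleC mult.commute)
    have "(\<lambda>n. tensor_lift B (c *\<^sub>C U n)) \<longlonglongrightarrow> c *\<^sub>C f u"
      unfolding tensor_lift_scaleC[OF B] U(2) by (intro bounded_linear.tendsto[OF bl] f U)
    moreover have "(\<lambda>n. tensor_lift B (c *\<^sub>C U n)) \<longlonglongrightarrow> f (c *\<^sub>C u)"
      unfolding U(2) abs_ptensor_scaleC[OF U(1)] by (intro f proj_Cauchy_scaleC U)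
    ultimately show ?thesis by (rule LIMSEQ_unique[symmetric])
  qed
  have f_norm: "norm (f u) \<le> K * norm u" for u
  proof -
    obtain U where U: "proj_Cauchy U" "u = abs_ptensor U" by (rule ptensor_cases)
    show ?thesis
      unfolding U(2)
      by (rule LIMSEQ_le[OF tendsto_norm[OF f[OF U(1)]] tendsto_mult_left[OF norm_abs_ptensor[OF U(1)]]])
        (simp add: bd)
  qed
  have "bounded_linear f"
    by (rule bounded_linear_intro[where K = K])
      (simp_all add: f_add f_scaleC f_norm mult.commute flip: scaleC_of_real)
  then have "bounded_clinear f" by (simp add: bounded_clinear_def f_scaleC)
  moreover have "f (a \<otimes>\<^sub>p b) = B a b" for a b
    using f[OF proj_Cauchy_const, of "etens a b"]
    by (simp add: ptens_def ptensor_embed_def tensor_lift_etens[OF B] LIMSEQ_const_iff)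
  ultimately show ?thesis using f_norm by blast
qed

definition ptensor_lift ::
    "('a::complex_normed_vector \<Rightarrow> 'b::complex_normed_vector \<Rightarrow> 'c::complex_banach) \<Rightarrow>
     ('a, 'b) ptensor \<Rightarrow> 'c" where
  "ptensor_lift B = (THE f. bounded_clinear f \<and> (\<forall>a b. f (a \<otimes>\<^sub>p b) = B a b))"

lemma ptensor_lift:
  fixes B :: "'a::complex_normed_vector \<Rightarrow> 'b::complex_normed_vector \<Rightarrow> 'c::complex_banach"
  assumes "cbilinear B" "\<And>a b. norm (B a b) \<le> K * (norm a * norm b)" "0 \<le> K"
  shows "bounded_clinear (ptensor_lift B)" "ptensor_lift B (a \<otimes>\<^sub>p b) = B a b"
    "norm (ptensor_lift B u) \<le> K * norm u"
proof -
  obtain f where f: "bounded_clinear f" "\<forall>a b. f (a \<otimes>\<^sub>p b) = B a b" "\<forall>u. norm (f u) \<le> K * norm u"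
    using ptensor_universal[OF assms] by blast
  have "ptensor_lift B = f"
    unfolding ptensor_lift_def
    by (rule the_equality) (use f in \<open>auto intro: bounded_clinear_ptensor_eqI\<close>)
  then show "bounded_clinear (ptensor_lift B)" "ptensor_lift B (a \<otimes>\<^sub>p b) = B a b"
    "norm (ptensor_lift B u) \<le> K * norm u"
    using f by simp_all
qed


section \<open>Banach algebras, bimodules and second duals\<close>

locale banach_algebra =
  fixes mul :: "'a::complex_banach \<Rightarrow> 'a \<Rightarrow> 'a"
  assumes mult_cbilinear: "cbilinear mul"
    and mult_assoc: "mul (mul a b) c = mul a (mul b c)"
    and mult_norm: "norm (mul a b) \<le> norm a * norm b"

definition unital :: "('a \<Rightarrow> 'a \<Rightarrow> 'a) \<Rightarrow> bool" where
  "unital mul \<longleftrightarrow> (\<exists>u. \<forall>a. mul u a = a \<and> mul a u = a)"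

definition mult_at :: "('a \<Rightarrow> 'a \<Rightarrow> 'a) \<Rightarrow> 'a \<Rightarrow> 'a \<Rightarrow> 'a \<Rightarrow> 'a" where
  "mult_at mul e a b = mul (mul a e) b"

lemma (in banach_algebra) banach_algebra_mult_at:
  assumes "norm e \<le> 1"
  shows "banach_algebra (mult_at mul e)"
proof
  show "cbilinear (mult_at mul e)"
    using mult_cbilinear by (simp add: cbilinear_def mult_at_def)
  show "mult_at mul e (mult_at mul e a b) c = mult_at mul e a (mult_at mul e b c)" for a b c
    by (simp add: mult_at_def mult_assoc)
  show "norm (mult_at mul e a b) \<le> norm a * norm b" for a b
  proof -
    have "norm (mul (mul a e) b) \<le> norm (mul a e) * norm b" by (rule mult_norm)
    also have "\<dots> \<le> (norm a * norm e) * norm b" by (intro mult_right_mono mult_norm norm_ge_zero)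
    also have "\<dots> \<le> (norm a * 1) * norm b"
      by (intro mult_right_mono mult_left_mono assms norm_ge_zero)
    finally show ?thesis by (simp add: mult_at_def)
  qed
qed

text \<open>A bimodule is given by its left action \<open>L a x = a \<cdot> x\<close> and its right action
  \<open>R a x = x \<cdot> a\<close>. On the dual, \<open>(a \<cdot> f)(x) = f(x \<cdot> a)\<close> and \<open>(f \<cdot> a)(x) = f(a \<cdot> x)\<close>.\<close>

definition dual_left ::
    "('a \<Rightarrow> 'x::complex_normed_vector \<Rightarrow> 'x) \<Rightarrow> 'a \<Rightarrow> 'x cdual \<Rightarrow> 'x cdual" where
  "dual_left R a = cadjoint (R a)"

definition dual_right ::
    "('a \<Rightarrow> 'x::complex_normed_vector \<Rightarrow> 'x) \<Rightarrow> 'a \<Rightarrow> 'x cdual \<Rightarrow> 'x cdual" where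
  "dual_right L a = cadjoint (L a)"

definition bidual_left ::
    "('a \<Rightarrow> 'x::complex_normed_vector \<Rightarrow> 'x) \<Rightarrow> 'a \<Rightarrow> 'x cdual cdual \<Rightarrow> 'x cdual cdual" where
  "bidual_left L = dual_left (dual_right L)"

definition bidual_right ::
    "('a \<Rightarrow> 'x::complex_normed_vector \<Rightarrow> 'x) \<Rightarrow> 'a \<Rightarrow> 'x cdual cdual \<Rightarrow> 'x cdual cdual" where
  "bidual_right R = dual_right (dual_left R)"

definition tensor_left ::
    "('a::complex_banach \<Rightarrow> 'a \<Rightarrow> 'a) \<Rightarrow> 'a \<Rightarrow> ('a, 'a) ptensor \<Rightarrow> ('a, 'a) ptensor" where
  "tensor_left mul a = ptensor_lift (\<lambda>b c. mul a b \<otimes>\<^sub>p c)"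

definition tensor_right ::
    "('a::complex_banach \<Rightarrow> 'a \<Rightarrow> 'a) \<Rightarrow> 'a \<Rightarrow> ('a, 'a) ptensor \<Rightarrow> ('a, 'a) ptensor" where
  "tensor_right mul a = ptensor_lift (\<lambda>b c. b \<otimes>\<^sub>p mul c a)"

definition tensor_prod ::
    "('a::complex_banach \<Rightarrow> 'a \<Rightarrow> 'a) \<Rightarrow> ('a, 'a) ptensor \<Rightarrow> 'a" where
  "tensor_prod mul = ptensor_lift mul"

context banach_algebra
begin

lemma tensor_prod:
  "bounded_clinear (tensor_prod mul)" "tensor_prod mul (a \<otimes>\<^sub>p b) = mul a b"
  unfolding tensor_prod_def
  using ptensor_lift[OF mult_cbilinear, of 1] by (simp_all add: mult_norm)

lemma tensor_left:
  "bounded_clinear (tensor_left mul a)" "tensor_left mul a (b \<otimes>\<^sub>p c) = mul a b \<otimes>\<^sub>p c"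
proof -
  have B: "cbilinear (\<lambda>b c :: 'a. mul a b \<otimes>\<^sub>p c)"
    using mult_cbilinear by (simp add: cbilinear_def cbilinear_ptens[unfolded cbilinear_def])
  have "norm (mul a b \<otimes>\<^sub>p c) \<le> norm a * (norm b * norm c)" for b c :: 'a
    using norm_ptens_le[of "mul a b" c] mult_right_mono[OF mult_norm[of a b], of "norm c"]
    by (simp add: mult.assoc)
  from ptensor_lift[OF B this norm_ge_zero]
  show "bounded_clinear (tensor_left mul a)" "tensor_left mul a (b \<otimes>\<^sub>p c) = mul a b \<otimes>\<^sub>p c"
    by (simp_all add: tensor_left_def)
qed

lemma tensor_right:
  "bounded_clinear (tensor_right mul a)" "tensor_right mul a (b \<otimes>\<^sub>p c) = b \<otimes>\<^sub>p mul c a"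
proof -
  have B: "cbilinear (\<lambda>b :: 'a. \<lambda>c. b \<otimes>\<^sub>p mul c a)"
    using mult_cbilinear by (simp add: cbilinear_def cbilinear_ptens[unfolded cbilinear_def])
  have "norm (b \<otimes>\<^sub>p mul c a) \<le> norm a * (norm b * norm c)" for b c :: 'a
    using norm_ptens_le[of b "mul c a"] mult_left_mono[OF mult_norm[of c a], of "norm b"]
    by (simp add: mult_ac)
  from ptensor_lift[OF B this norm_ge_zero]
  show "bounded_clinear (tensor_right mul a)" "tensor_right mul a (b \<otimes>\<^sub>p c) = b \<otimes>\<^sub>p mul c a"
    by (simp_all add: tensor_right_def)
qed

end

lemma cadjoint_apply:
  assumes "bounded_clinear T"
  shows "cdual_apply (cadjoint T f) x = cdual_apply f (T x)"
proof -
  have "bounded_clinear (\<lambda>x. cdual_apply f (T x))"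
    using assms bounded_clinear_cdual_apply[of f]
    by (simp add: bounded_clinear_def bounded_linear_compose)
  then show ?thesis by (simp add: cadjoint_def cdual_apply_CDual)
qed

lemma bounded_clinear_cadjoint:
  assumes T: "bounded_clinear T"
  shows "bounded_clinear (cadjoint T)"
proof -
  obtain K where K: "0 < K" "\<And>x. norm (T x) \<le> norm x * K"
    using bounded_linear.pos_bounded[of T] T by (auto simp: bounded_clinear_def)
  have "bounded_linear (cadjoint T)"
  proof (rule bounded_linear_intro[where K = K])
    show "norm (cadjoint T f) \<le> norm f * K" for f
    proof (rule norm_cdual_bound)
      show "cmod (cdual_apply (cadjoint T f) x) \<le> norm f * K * norm x" for x
        using norm_cdual_apply[of f "T x"] mult_left_mono[OF K(2)[of x], of "norm f"]
        by (simp add: cadjoint_apply[OF T] mult_ac)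
    qed (use K(1) in simp)
  qed (rule cdual_eqI, simp add: cadjoint_apply[OF T] cdual_apply_simps)+
  moreover have "cadjoint T (c *\<^sub>C f) = c *\<^sub>C cadjoint T f" for c f
    by (rule cdual_eqI) (simp add: cadjoint_apply[OF T] cdual_apply_simps)
  ultimately show ?thesis by (simp add: bounded_clinear_def)
qed

lemma bidual_embed_apply: "cdual_apply (bidual_embed x) f = cdual_apply f x"
proof -
  have "bounded_clinear (\<lambda>f. cdual_apply f x)"
    unfolding bounded_clinear_def
  proof
    show "bounded_linear (\<lambda>f. cdual_apply f x)"
      by (rule bounded_linear_intro[where K = "norm x"])
        (simp_all add: cdual_apply_simps norm_cdual_apply)
  qed (simp add: cdual_apply_simps scaleC_complex_def)
  then show ?thesis by (simp add: bidual_embed_def cdual_apply_CDual)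
qed

section \<open>Johnson pseudo-contractibility\<close>

definition directed_index :: "'i set \<Rightarrow> ('i \<Rightarrow> 'i \<Rightarrow> bool) \<Rightarrow> bool" where
  "directed_index I le \<longleftrightarrow> I \<noteq> {} \<and> (\<forall>i\<in>I. le i i) \<and>
     (\<forall>i\<in>I. \<forall>j\<in>I. \<forall>k\<in>I. le i j \<longrightarrow> le j k \<longrightarrow> le i k) \<and>
     (\<forall>i\<in>I. \<forall>j\<in>I. \<exists>k\<in>I. le i k \<and> le j k)"

definition net_filter :: "'i set \<Rightarrow> ('i \<Rightarrow> 'i \<Rightarrow> bool) \<Rightarrow> 'i filter" where
  "net_filter I le = (INF i\<in>I. principal {j\<in>I. le i j})"

lemma directed_index_trans:
  "directed_index I le \<Longrightarrow> i \<in> I \<Longrightarrow> j \<in> I \<Longrightarrow> k \<in> I \<Longrightarrow> le i j \<Longrightarrow> le j k \<Longrightarrow> le i k"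
  unfolding directed_index_def by meson

lemma eventually_net_filter:
  assumes "directed_index I le"
  shows "eventually P (net_filter I le) \<longleftrightarrow> (\<exists>i\<in>I. \<forall>j\<in>I. le i j \<longrightarrow> P j)"
proof -
  have "eventually P (net_filter I le) \<longleftrightarrow> (\<exists>i\<in>I. eventually P (principal {j\<in>I. le i j}))"
    unfolding net_filter_def
  proof (rule eventually_INF_base)
    show "I \<noteq> {}" using assms by (simp add: directed_index_def)
    fix i j assume ij: "i \<in> I" "j \<in> I"
    then obtain k where k: "k \<in> I" "le i k" "le j k"
      using assms unfolding directed_index_def by meson
    have "{l\<in>I. le k l} \<subseteq> {l\<in>I. le i l} \<inter> {l\<in>I. le j l}"
      using directed_index_trans[OF assms] ij k by blast
    then show "\<exists>k\<in>I. principal {l\<in>I. le k l} \<le> inf (principal {l\<in>I. le i l}) (principal {l\<in>I. le j l})"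
      using k(1) by (intro bexI[of _ k]) (simp_all only: inf_principal principal_le_iff)
  qed
  then show ?thesis by (auto simp: eventually_principal)
qed

definition johnson_net ::
    "('a::complex_banach \<Rightarrow> 'a \<Rightarrow> 'a) \<Rightarrow> 'i set \<Rightarrow> ('i \<Rightarrow> 'i \<Rightarrow> bool) \<Rightarrow>
     ('i \<Rightarrow> ('a, 'a) ptensor cdual cdual) \<Rightarrow> bool" where
  "johnson_net mul I le m \<longleftrightarrow> directed_index I le \<and>
     (\<forall>a. (\<forall>i\<in>I. bidual_left (tensor_left mul) a (m i) = bidual_right (tensor_right mul) a (m i)) \<and>
       ((\<lambda>i. bidual_right (\<lambda>a x. mul x a) a (cadjoint (cadjoint (tensor_prod mul)) (m i)) -
          bidual_embed a) \<longlongrightarrow> 0) (net_filter I le))"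

text \<open>A formula cannot quantify over the type of indices. The type fixed here is large enough for
  every net, see the lemma below.\<close>

definition johnson_pseudo_contractible :: "('a::complex_banach \<Rightarrow> 'a \<Rightarrow> 'a) \<Rightarrow> bool" where
  "johnson_pseudo_contractible mul \<longleftrightarrow>
     (\<exists>(I :: (('a, 'a) ptensor cdual cdual set \<times> ('a, 'a) ptensor cdual cdual) set) le m.
        johnson_net mul I le m)"

lemma johnson_pseudo_contractibleI:
  fixes I :: "'i set" and m :: "'i \<Rightarrow> ('a::complex_banach, 'a) ptensor cdual cdual"
  assumes net: "johnson_net mul I le m"
  shows "johnson_pseudo_contractible mul"
proof -
  have dir: "directed_index I le" using net by (simp add: johnson_net_def)
  define T where "T i = m ` {j\<in>I. le i j}" for i
  define J where "J = {(S, x). S \<in> T ` I \<and> x \<in> S}"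
  define leJ where "leJ p q \<longleftrightarrow> fst q \<subseteq> fst p"
    for p q :: "('a, 'a) ptensor cdual cdual set \<times> ('a, 'a) ptensor cdual cdual"
  have TJ: "(T i, m i) \<in> J" if "i \<in> I" for i
  proof -
    have "le i i" using dir that unfolding directed_index_def by blast
    then show ?thesis using that by (auto simp: J_def T_def)
  qed
  have dirJ: "directed_index J leJ"
    unfolding directed_index_def
  proof (intro conjI ballI impI)
    show "J \<noteq> {}" using TJ dir unfolding directed_index_def by blast
    fix p q assume p: "p \<in> J" and q: "q \<in> J"
    obtain i j where ij: "i \<in> I" "j \<in> I" "fst p = T i" "fst q = T j"
      using p q by (auto simp: J_def)
    obtain k where k: "k \<in> I" "le i k" "le j k"
      using dir ij unfolding directed_index_def by meson
    have "T k \<subseteq> T i" "T k \<subseteq> T j"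
      using directed_index_trans[OF dir] ij k unfolding T_def by blast+
    then have "leJ p (T k, m k) \<and> leJ q (T k, m k)"
      using ij by (simp add: leJ_def)
    then show "\<exists>r\<in>J. leJ p r \<and> leJ q r"
      using TJ[OF k(1)] by blast
  qed (unfold leJ_def, blast+)
  have ev: "eventually (\<lambda>p. P (snd p)) (net_filter J leJ)"
    if P: "eventually (\<lambda>i. P (m i)) (net_filter I le)" for P
  proof -
    obtain i where i: "i \<in> I" "\<And>j. j \<in> I \<Longrightarrow> le i j \<Longrightarrow> P (m j)"
      using P unfolding eventually_net_filter[OF dir] by blast
    have "P (snd q)" if "q \<in> J" "leJ (T i, m i) q" for q
    proof -
      have "snd q \<in> T i" using that by (auto simp: J_def leJ_def)
      then show ?thesis using i(2) by (auto simp: T_def)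
    qed
    then show ?thesis
      unfolding eventually_net_filter[OF dirJ] using TJ[OF i(1)] by blast
  qed
  have "johnson_net mul J leJ snd"
    unfolding johnson_net_def
  proof (intro conjI allI ballI)
    show "directed_index J leJ" by (rule dirJ)
    show "bidual_left (tensor_left mul) a (snd p) = bidual_right (tensor_right mul) a (snd p)"
      if "p \<in> J" for a p
    proof -
      obtain i where "i \<in> I" "snd p = m i" using \<open>p \<in> J\<close> by (auto simp: J_def T_def)
      then show ?thesis using net unfolding johnson_net_def by simp
    qed
    show "((\<lambda>p. bidual_right (\<lambda>a x. mul x a) a (cadjoint (cadjoint (tensor_prod mul)) (snd p)) -
        bidual_embed a) \<longlongrightarrow> 0) (net_filter J leJ)" for a
    proof (rule topological_tendstoI)
      fix S :: "'a cdual cdual set" assume "open S" "0 \<in> S"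
      then have "eventually (\<lambda>i. bidual_right (\<lambda>a x. mul x a) a
          (cadjoint (cadjoint (tensor_prod mul)) (m i)) - bidual_embed a \<in> S) (net_filter I le)"
        using net unfolding johnson_net_def by (intro topological_tendstoD) blast+
      then show "eventually (\<lambda>p. bidual_right (\<lambda>a x. mul x a) a
          (cadjoint (cadjoint (tensor_prod mul)) (snd p)) - bidual_embed a \<in> S) (net_filter J leJ)"
        by (rule ev)
    qed
  qed
  then show ?thesis unfolding johnson_pseudo_contractible_def by blast
qed

end

theory Submission
  imports Defs
begin

text \<open>Let \<open>u\<close> be the unit of \<open>A\<^sub>e\<close>. Then \<open>u e a = a = a e u\<close> for all \<open>a\<close>, so \<open>u e\<close> is a left
  identity and \<open>e u\<close> is a right identity of \<open>A\<close>. The two therefore coincide: \<open>A\<close> itself is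
  unital, and \<open>e\<close> is invertible with inverse \<open>u\<close>. Hence \<open>a \<mapsto> a e\<close> is a bounded isomorphism from
  \<open>A\<^sub>e\<close> onto \<open>A\<close>, because \<open>(a e) (b e) = (a * b) e\<close>, and its inverse \<open>a \<mapsto> a u\<close> is bounded as well.

  It remains to see that Johnson pseudo-contractibility passes along a bounded surjective
  homomorphism \<open>\<phi> : A \<rightarrow> B\<close> (\<open>johnson_pseudo_contractible_surj_hom\<close>). If \<open>(m\<^sub>\<alpha>)\<close> is a
  net for \<open>A\<close>, then its image under the second adjoint of \<open>\<phi> \<otimes> \<phi>\<close> is a net for \<open>B\<close>. Each of the
  operations in the definition, applied at a fixed \<open>a\<close>, is the second adjoint of a bounded map on
  \<open>A\<close> or on the tensor product; these maps are intertwined by \<open>\<phi>\<close> and \<open>\<phi> \<otimes> \<phi>\<close>, and second adjoints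
  preserve commuting squares. Surjectivity ensures that every element of \<open>B\<close> is some \<open>\<phi> a\<close>.\<close>

lemma bounded_clinear_compose:
  assumes "bounded_clinear S" "bounded_clinear T"
  shows "bounded_clinear (\<lambda>x. S (T x))"
  using assms by (simp add: bounded_clinear_def bounded_linear_compose)

lemma bounded_clinear_diff: "bounded_clinear f \<Longrightarrow> f (x - y) = f x - f y"
  by (simp add: bounded_clinear_def linear_diff bounded_linear.linear)

lemma biadjoint_compose:
  assumes S: "bounded_clinear S" and T: "bounded_clinear T"
  shows "cadjoint (cadjoint S) (cadjoint (cadjoint T) m) = cadjoint (cadjoint (\<lambda>x. S (T x))) m"
proof -
  have "cadjoint (\<lambda>x. S (T x)) f = cadjoint T (cadjoint S f)" for f
    by (rule cdual_eqI) (simp add: cadjoint_apply S T bounded_clinear_compose)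
  then show ?thesis
    by (intro cdual_eqI) (simp add: cadjoint_apply bounded_clinear_cadjoint S T bounded_clinear_compose)
qed

text \<open>Functoriality of the second adjoint in the form in which it is used: a square that commutes on
  the spaces also commutes on their second duals.\<close>

lemma biadjoint_square:
  assumes "bounded_clinear S" "bounded_clinear T" "bounded_clinear S'" "bounded_clinear T'"
    and "\<And>x. S (T x) = S' (T' x)"
  shows "cadjoint (cadjoint S) (cadjoint (cadjoint T) m) =
    cadjoint (cadjoint S') (cadjoint (cadjoint T') m)"
  using assms by (simp add: biadjoint_compose)

lemma biadjoint_bidual_embed:
  assumes "bounded_clinear T"
  shows "cadjoint (cadjoint T) (bidual_embed x) = bidual_embed (T x)"
  by (rule cdual_eqI)
    (simp add: cadjoint_apply bounded_clinear_cadjoint bidual_embed_apply assms)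

lemma bidual_left_eq_biadjoint: "bidual_left L a = cadjoint (cadjoint (L a))"
  by (simp add: bidual_left_def dual_left_def dual_right_def)

lemma bidual_right_eq_biadjoint: "bidual_right R a = cadjoint (cadjoint (R a))"
  by (simp add: bidual_right_def dual_left_def dual_right_def)

definition ptensor_map ::
    "('a::complex_banach \<Rightarrow> 'b::complex_banach) \<Rightarrow> ('a, 'a) ptensor \<Rightarrow> ('b, 'b) ptensor" where
  "ptensor_map \<phi> = ptensor_lift (\<lambda>a b. \<phi> a \<otimes>\<^sub>p \<phi> b)"

lemma ptensor_map:
  fixes \<phi> :: "'a::complex_banach \<Rightarrow> 'b::complex_banach"
  assumes \<phi>: "bounded_clinear \<phi>"
  shows "bounded_clinear (ptensor_map \<phi>)" "ptensor_map \<phi> (a \<otimes>\<^sub>p b) = \<phi> a \<otimes>\<^sub>p \<phi> b"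
proof -
  obtain K where K: "0 < K" "\<And>x. norm (\<phi> x) \<le> norm x * K"
    using bounded_linear.pos_bounded[of \<phi>] \<phi> by (auto simp: bounded_clinear_def)
  have B: "cbilinear (\<lambda>a b. \<phi> a \<otimes>\<^sub>p \<phi> b)"
    using \<phi> bounded_clinear_add[OF \<phi>]
    by (simp add: cbilinear_def bounded_clinear_def cbilinear_ptens[unfolded cbilinear_def])
  have bd: "norm (\<phi> a \<otimes>\<^sub>p \<phi> b) \<le> K * K * (norm a * norm b)" for a b
  proof -
    have "norm (\<phi> a \<otimes>\<^sub>p \<phi> b) \<le> norm (\<phi> a) * norm (\<phi> b)" by (rule norm_ptens_le)
    also have "\<dots> \<le> (norm a * K) * (norm b * K)"
      using K(1) by (intro mult_mono K(2)) simp_all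
    finally show ?thesis by (simp add: mult_ac)
  qed
  have "0 \<le> K * K" by simp
  from ptensor_lift[OF B bd this]
  show "bounded_clinear (ptensor_map \<phi>)" "ptensor_map \<phi> (a \<otimes>\<^sub>p b) = \<phi> a \<otimes>\<^sub>p \<phi> b"
    by (simp_all add: ptensor_map_def)
qed

lemma (in banach_algebra) bounded_clinear_mult_left: "bounded_clinear (\<lambda>x. mul x a)"
proof -
  have "(r *\<^sub>R x) = of_real r *\<^sub>C x" for r and x :: 'a
    by (simp add: scaleC_of_real)
  then have "bounded_linear (\<lambda>x. mul x a)"
    using mult_cbilinear mult_norm
    by (intro bounded_linear_intro[where K = "norm a"]) (simp_all add: cbilinear_def)
  then show ?thesis
    using mult_cbilinear by (simp add: bounded_clinear_def cbilinear_def)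
qed

theorem johnson_pseudo_contractible_surj_hom:
  fixes mulA :: "'a::complex_banach \<Rightarrow> 'a \<Rightarrow> 'a" and mulB :: "'b::complex_banach \<Rightarrow> 'b \<Rightarrow> 'b"
  assumes A: "banach_algebra mulA" and B: "banach_algebra mulB"
    and \<phi>: "bounded_clinear \<phi>" and surj: "surj \<phi>"
    and hom: "\<And>a b. \<phi> (mulA a b) = mulB (\<phi> a) (\<phi> b)"
    and JPC: "johnson_pseudo_contractible mulA"
  shows "johnson_pseudo_contractible mulB"
proof -
  interpret A: banach_algebra mulA by (rule A)
  interpret B: banach_algebra mulB by (rule B)
  obtain I :: "(('a, 'a) ptensor cdual cdual set \<times> ('a, 'a) ptensor cdual cdual) set" and le m
    where net: "johnson_net mulA I le m"
    using JPC unfolding johnson_pseudo_contractible_def by blast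
  define \<Phi> where "\<Phi> = ptensor_map \<phi>"
  define M where "M i = cadjoint (cadjoint \<Phi>) (m i)" for i
  have \<Phi>: "bounded_clinear \<Phi>" "\<Phi> (a \<otimes>\<^sub>p b) = \<phi> a \<otimes>\<^sub>p \<phi> b" for a b
    using ptensor_map[OF \<phi>] by (simp_all add: \<Phi>_def)
  \<comment> \<open>Maps on the projective tensor product are compared on elementary tensors.\<close>
  have left: "tensor_left mulB (\<phi> a) (\<Phi> x) = \<Phi> (tensor_left mulA a x)" for a x
    by (rule fun_cong[OF bounded_clinear_ptensor_eqI])
      (simp_all add: bounded_clinear_compose \<Phi> A.tensor_left B.tensor_left hom)
  have right: "tensor_right mulB (\<phi> a) (\<Phi> x) = \<Phi> (tensor_right mulA a x)" for a x
    by (rule fun_cong[OF bounded_clinear_ptensor_eqI])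
      (simp_all add: bounded_clinear_compose \<Phi> A.tensor_right B.tensor_right hom)
  have prod: "tensor_prod mulB (\<Phi> x) = \<phi> (tensor_prod mulA x)" for x
    by (rule fun_cong[OF bounded_clinear_ptensor_eqI])
      (simp_all add: bounded_clinear_compose \<Phi> \<phi> A.tensor_prod B.tensor_prod hom)
  have "johnson_net mulB I le M"
    unfolding johnson_net_def
  proof (intro conjI allI ballI)
    show "directed_index I le" using net by (simp add: johnson_net_def)
  next
    fix b i assume i: "i \<in> I"
    obtain a where b: "b = \<phi> a" using surj by (rule surjE)
    have "bidual_left (tensor_left mulB) b (M i) =
        cadjoint (cadjoint \<Phi>) (bidual_left (tensor_left mulA) a (m i))"
      unfolding bidual_left_eq_biadjoint M_def b
      by (rule biadjoint_square) (simp_all add: \<Phi> A.tensor_left B.tensor_left left)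
    also have "\<dots> = cadjoint (cadjoint \<Phi>) (bidual_right (tensor_right mulA) a (m i))"
      using net i by (simp add: johnson_net_def)
    also have "\<dots> = bidual_right (tensor_right mulB) b (M i)"
      unfolding bidual_right_eq_biadjoint M_def b
      by (rule biadjoint_square) (simp_all add: \<Phi> A.tensor_right B.tensor_right right)
    finally show "bidual_left (tensor_left mulB) b (M i) = bidual_right (tensor_right mulB) b (M i)" .
  next
    fix b
    obtain a where b: "b = \<phi> a" using surj by (rule surjE)
    define X where "X i = bidual_right (\<lambda>a x. mulA x a) a (cadjoint (cadjoint (tensor_prod mulA)) (m i)) -
        bidual_embed a" for i
    have \<phi>2: "bounded_clinear (cadjoint (cadjoint \<phi>))"
      by (intro bounded_clinear_cadjoint \<phi>)
    have "bidual_right (\<lambda>a x. mulB x a) b (cadjoint (cadjoint (tensor_prod mulB)) (M i)) -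
        bidual_embed b = cadjoint (cadjoint \<phi>) (X i)" for i
    proof -
      have "cadjoint (cadjoint (tensor_prod mulB)) (M i) =
          cadjoint (cadjoint \<phi>) (cadjoint (cadjoint (tensor_prod mulA)) (m i))"
        unfolding M_def
        by (rule biadjoint_square) (simp_all add: \<Phi> \<phi> A.tensor_prod B.tensor_prod prod)
      moreover have "bidual_right (\<lambda>a x. mulB x a) b (cadjoint (cadjoint \<phi>) n) =
          cadjoint (cadjoint \<phi>) (bidual_right (\<lambda>a x. mulA x a) a n)" for n
        unfolding bidual_right_eq_biadjoint b
        by (rule biadjoint_square)
          (simp_all add: \<phi> A.bounded_clinear_mult_left B.bounded_clinear_mult_left hom)
      ultimately show ?thesis
        by (simp add: X_def b bounded_clinear_diff[OF \<phi>2] biadjoint_bidual_embed[OF \<phi>])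
    qed
    moreover have "(X \<longlongrightarrow> 0) (net_filter I le)"
      using net unfolding johnson_net_def X_def by blast
    then have "((\<lambda>i. cadjoint (cadjoint \<phi>) (X i)) \<longlongrightarrow> 0) (net_filter I le)"
      using bounded_clinear_tendsto[OF \<phi>2] bounded_clinear_zero[OF \<phi>2] by metis
    ultimately show "((\<lambda>i. bidual_right (\<lambda>a x. mulB x a) b
        (cadjoint (cadjoint (tensor_prod mulB)) (M i)) - bidual_embed b) \<longlongrightarrow> 0) (net_filter I le)"
      by simp
  qed
  then show ?thesis by (rule johnson_pseudo_contractibleI)
qed

text \<open>A left identity \<open>u e\<close> and a right identity \<open>e u\<close> agree, since each equals their product.\<close>

lemma (in banach_algebra) unital_mult_at_imp_invertible:
  assumes "unital (mult_at mul e)"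
  obtains u where "\<And>a. mul (mul a e) u = a" "\<And>a. mul (mul a u) e = a"
proof -
  obtain u where u: "\<And>a. mul (mul u e) a = a" "\<And>a. mul (mul a e) u = a"
    using assms unfolding unital_def mult_at_def by blast
  have "mul u e = mul e u"
    using u(1)[of "mul e u"] u(2)[of "mul u e"] by (simp add: mult_assoc)
  then show ?thesis using that u by (metis mult_assoc)
qed

theorem proposition3p5:
  fixes mul :: "'a::complex_banach \<Rightarrow> 'a \<Rightarrow> 'a" and e :: 'a
  assumes "banach_algebra mul"
    and "norm e \<le> 1"
    and "unital (mult_at mul e)"
  shows "johnson_pseudo_contractible mul \<longleftrightarrow> johnson_pseudo_contractible (mult_at mul e)"
proof -
  interpret banach_algebra mul by (rule assms(1))
  have Ae: "banach_algebra (mult_at mul e)" by (rule banach_algebra_mult_at[OF assms(2)])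
  obtain u where u: "\<And>a. mul (mul a e) u = a" "\<And>a. mul (mul a u) e = a"
    using unital_mult_at_imp_invertible[OF assms(3)] by blast
  show ?thesis
  proof
    assume "johnson_pseudo_contractible mul"
    moreover have "surj (\<lambda>a. mul a u)" using u(1) by (rule surjI)
    moreover have "mul (mul a b) u = mult_at mul e (mul a u) (mul b u)" for a b
      by (simp only: mult_at_def u(2) mult_assoc[of a b])
    ultimately show "johnson_pseudo_contractible (mult_at mul e)"
      using johnson_pseudo_contractible_surj_hom[OF assms(1) Ae bounded_clinear_mult_left] by blast
  next
    assume "johnson_pseudo_contractible (mult_at mul e)"
    moreover have "surj (\<lambda>a. mul a e)" using u(2) by (rule surjI)
    moreover have "mul (mult_at mul e a b) e = mul (mul a e) (mul b e)" for a b
      by (simp add: mult_at_def mult_assoc)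
    ultimately show "johnson_pseudo_contractible mul"
      using johnson_pseudo_contractible_surj_hom[OF Ae assms(1) bounded_clinear_mult_left] by blast
  qed
qed

end
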